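(* Let $a\ge2$ be an integer, $H=\langle a,a+1\rangle$, $k$ a field, $A=k[[H]]=k[[t^a,t^{a+1}]]\subseteq k[[t]]$, and $\mathfrak m=(t^a,t^{a+1})$ the maximal ideal of $A$. Let $0<s\in H$, let $q>0$ be an integer, and put $Q=(t^s)$ and $I=Q:\mathfrak m^q$. Assume that $q<a$. Then the following assertions hold. (1) $I^2=QI$ if $s\ge aq$. (2) $I^3=QI^2$ and $\mathrm G(I)=\bigoplus_{n\ge0}I^n/I^{n+1}$ is a Cohen-Macaulay ring, if $s\ge a(q-1)$.
   Context: $\langle a,a+1\rangle=\{\alpha a+\beta(a+1)\mid 0\le\alpha,\beta\in\mathbb Z\}$. $k[[t]]$ is the formal power series ring in an indeterminate $t$; $Q:\mathfrak m^q=\{x\in A\mid\mathfrak m^qx\subseteq Q\}$. *)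

theory Defs
  imports
    "HOL-Computational_Algebra.Formal_Power_Series"
    "HOL-Library.Extended_Nat"
    "HOL-Algebra.Ideal_Product"
    "HOL-Algebra.QuotRing"
    "HOL-Algebra.Ring_Divisibility"
begin

section \<open>Semigroup rings inside \<open>k[[t]]\<close>\<close>

definition semigroup_gen2 :: "nat \<Rightarrow> nat \<Rightarrow> nat set"
  where "semigroup_gen2 a b = {\<alpha> * a + \<beta> * b | \<alpha> \<beta>. True}"

text \<open>\<open>k[[H]]\<close> consists of the power series supported on \<open>H\<close>; the indeterminate \<open>t\<close> is
  \<^const>\<open>fps_X\<close>. For \<open>H = \<langle>a, b\<rangle>\<close> this is \<open>k[[t^a, t^b]]\<close>.\<close>

definition semigroup_ring :: "nat set \<Rightarrow> 'k::field fps ring"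
  where "semigroup_ring H =
    \<lparr>carrier = {f. \<forall>n. fps_nth f n \<noteq> 0 \<longrightarrow> n \<in> H},
     mult = (*), one = 1, zero = 0, add = (+)\<rparr>"


section \<open>Ideal powers, colon ideals and associated graded rings\<close>

abbreviation ideal_pow :: "('a, 'm) ring_scheme \<Rightarrow> 'a set \<Rightarrow> nat \<Rightarrow> 'a set"
  where "ideal_pow R I n \<equiv> I [^]\<^bsub>ideals_set R\<^esub> n"

definition colon_ideal :: "('a, 'm) ring_scheme \<Rightarrow> 'a set \<Rightarrow> 'a set \<Rightarrow> 'a set"
  where "colon_ideal R I J = {x \<in> carrier R. \<forall>y\<in>J. y \<otimes>\<^bsub>R\<^esub> x \<in> I}"

text \<open>The associated graded ring \<open>G(I) = \<Oplus>\<^sub>n I^n / I^(n+1)\<close>. An element is the family of its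
  homogeneous components: the \<open>n\<close>-th one is a coset of \<open>I^(n+1)\<close> represented in \<open>I^n\<close>, and it is
  zero, i.e. \<open>I^(n+1)\<close> itself, for almost all \<open>n\<close>. The classes of \<open>x \<in> I^i\<close> and \<open>y \<in> I^j\<close>
  multiply to the class of \<open>x y\<close> modulo \<open>I^(i+j+1)\<close>.\<close>

definition assoc_graded :: "('a, 'm) ring_scheme \<Rightarrow> 'a set \<Rightarrow> (nat \<Rightarrow> 'a set) ring"
  where "assoc_graded R I =
    \<lparr>carrier = {u. (\<forall>n. \<exists>x \<in> ideal_pow R I n. u n = ideal_pow R I (n + 1) +>\<^bsub>R\<^esub> x) \<and>
                  finite {n. u n \<noteq> ideal_pow R I (n + 1)}},
     mult = (\<lambda>u v n. finsum (R Quot ideal_pow R I (n + 1))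
                (\<lambda>i. rcoset_mult R (ideal_pow R I (n + 1)) (u i) (v (n - i))) {..n}),
     one = (\<lambda>n. if n = 0 then I +>\<^bsub>R\<^esub> \<one>\<^bsub>R\<^esub> else ideal_pow R I (n + 1)),
     zero = (\<lambda>n. ideal_pow R I (n + 1)),
     add = (\<lambda>u v n. u n <+>\<^bsub>R\<^esub> v n)\<rparr>"


section \<open>Localization\<close>

text \<open>The fraction \<open>r / s\<close> as an equivalence class of pairs; the factor \<open>u\<close> is needed because \<open>S\<close>
  may contain zero divisors.\<close>

definition frac_class :: "('a, 'm) ring_scheme \<Rightarrow> 'a set \<Rightarrow> 'a \<Rightarrow> 'a \<Rightarrow> ('a \<times> 'a) set"
  where "frac_class R S r s =
    {(r', s'). r' \<in> carrier R \<and> s' \<in> S \<and>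
       (\<exists>u\<in>S. u \<otimes>\<^bsub>R\<^esub> (s' \<otimes>\<^bsub>R\<^esub> r) = u \<otimes>\<^bsub>R\<^esub> (s \<otimes>\<^bsub>R\<^esub> r'))}"

text \<open>As in \<^const>\<open>rcoset_mult\<close>, the unions below range over all representatives; the classes
  united are all equal.\<close>

definition localization :: "('a, 'm) ring_scheme \<Rightarrow> 'a set \<Rightarrow> ('a \<times> 'a) set ring"
  where "localization R S =
    \<lparr>carrier = {frac_class R S r s | r s. r \<in> carrier R \<and> s \<in> S},
     mult = (\<lambda>X Y. \<Union>(r, s)\<in>X. \<Union>(r', s')\<in>Y.
               frac_class R S (r \<otimes>\<^bsub>R\<^esub> r') (s \<otimes>\<^bsub>R\<^esub> s')),
     one = frac_class R S \<one>\<^bsub>R\<^esub> \<one>\<^bsub>R\<^esub>,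
     zero = frac_class R S \<zero>\<^bsub>R\<^esub> \<one>\<^bsub>R\<^esub>,
     add = (\<lambda>X Y. \<Union>(r, s)\<in>X. \<Union>(r', s')\<in>Y.
               frac_class R S (s' \<otimes>\<^bsub>R\<^esub> r \<oplus>\<^bsub>R\<^esub> s \<otimes>\<^bsub>R\<^esub> r') (s \<otimes>\<^bsub>R\<^esub> s'))\<rparr>"


section \<open>Cohen--Macaulay rings\<close>

definition krull_dim :: "('a, 'm) ring_scheme \<Rightarrow> enat"
  where "krull_dim R = Sup {enat n | n. \<exists>P :: nat \<Rightarrow> 'a set.
    (\<forall>i\<le>n. primeideal (P i) R) \<and> (\<forall>i<n. P i \<subset> P (Suc i))}"

definition regular_sequence :: "('a, 'm) ring_scheme \<Rightarrow> 'a list \<Rightarrow> bool"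
  where "regular_sequence R xs \<longleftrightarrow>
    set xs \<subseteq> carrier R \<and> Idl\<^bsub>R\<^esub> (set xs) \<noteq> carrier R \<and>
    (\<forall>i < length xs. \<forall>r \<in> carrier R.
       xs ! i \<otimes>\<^bsub>R\<^esub> r \<in> Idl\<^bsub>R\<^esub> (set (take i xs)) \<longrightarrow> r \<in> Idl\<^bsub>R\<^esub> (set (take i xs)))"

definition depth :: "('a, 'm) ring_scheme \<Rightarrow> 'a set \<Rightarrow> enat"
  where "depth R M = Sup {enat (length xs) | xs. set xs \<subseteq> M \<and> regular_sequence R xs}"

definition cohen_macaulay_local_ring :: "('a, 'm) ring_scheme \<Rightarrow> bool"
  where "cohen_macaulay_local_ring R \<longleftrightarrow> cring R \<and> noetherian_ring R \<and>
    (\<exists>M. {N. maximalideal N R} = {M} \<and> depth R M = krull_dim R)"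

definition cohen_macaulay_ring :: "('a, 'm) ring_scheme \<Rightarrow> bool"
  where "cohen_macaulay_ring R \<longleftrightarrow> cring R \<and> noetherian_ring R \<and>
    (\<forall>M. maximalideal M R \<longrightarrow> cohen_macaulay_local_ring (localization R (carrier R - M)))"

end

theory Submission
  imports Defs "HOL-Computational_Algebra.Polynomial"
begin

text \<open>All ideals in sight are spanned, in the sense of power series, by monomials, so that products and
  colons become operations on exponent sets. Looking at runs of \<open>q + 1\<close> consecutive elements of \<open>H\<close> shows
  that \<open>I = Q : \<mm>^q\<close> has exponents \<open>E = (s + H) \<union> {h \<in> H. h \<ge> N}\<close> with \<open>N = s + a (a - 1 - q)\<close>.
  Both \<open>I\<^sup>2 = QI\<close> and \<open>I\<^sup>3 = QI\<^sup>2\<close> then amount to moving a sum of exponents down by \<open>s\<close>, and the only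
  possible obstruction is the Frobenius number \<open>a (a - 1) - 1\<close>.

  The same description gives \<open>Q \<inter> I^(n+1) = Q I^n\<close>, so the initial form \<open>f\<close> of \<open>t^s\<close> is a
  nonzerodivisor on \<open>G(I)\<close>. Since \<open>G(I)\<close> is a finite algebra over \<open>k[f]\<close> and every other monomial is
  nilpotent, \<open>G(I)\<close> modulo its nilradical is the polynomial ring \<open>k[f]\<close> and every element outside
  the nilradical is a nonzerodivisor. Hence all localizations at maximal ideals have dimension and depth one.\<close>

section \<open>Localization\<close>

text \<open>Cohen-Macaulayness is asked at every maximal ideal of G(I), not only at the homogeneous
  one, and k need not be algebraically closed. Instead of classifying these ideals, the proof
  isolates a criterion, \<open>cohen_macaulay_poly_quotient\<close>: a noetherian ring with a
  surjection onto k[X] whose kernel is nil and off which every element is a nonzerodivisor. Each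
  maximal ideal is then governed by a single polynomial p. The two thresholds for s locate N
  relative to the gaps of H. The bound s \<ge> a q puts N at or beyond the conductor a (a - 1), so u
  + v - s cannot be a gap when u and v are at least N. The weaker bound s \<ge> a (q - 1) only gives
  N \<ge> a (a - 2), from where on a single gap, the Frobenius number, remains. Then I^2 = Q I may
  fail (a = 3, q = 2, s = 3), and a third factor is needed to move around that gap.\<close>

locale localization_at = cring R for R (structure) +
  fixes S
  assumes S_submonoid: "submonoid S R"
begin

lemma S_closed [simp, intro]: "s \<in> S \<Longrightarrow> s \<in> carrier R"
  by (rule submonoid.mem_carrier[OF S_submonoid])

lemma S_one [simp, intro]: "\<one> \<in> S"
  by (rule submonoid.one_closed[OF S_submonoid])

lemma S_mult [simp, intro]: "s \<in> S \<Longrightarrow> t \<in> S \<Longrightarrow> s \<otimes> t \<in> S"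
  by (rule submonoid.m_closed[OF S_submonoid])

abbreviation frac where "frac \<equiv> frac_class R S"

abbreviation Loc where "Loc \<equiv> localization R S"

lemma mem_frac_iff:
  "(r', s') \<in> frac r s \<longleftrightarrow>
     r' \<in> carrier R \<and> s' \<in> S \<and> (\<exists>u\<in>S. u \<otimes> (s' \<otimes> r) = u \<otimes> (s \<otimes> r'))"
  by (simp add: frac_class_def)

lemma frac_eq_iff:
  assumes [simp]: "r \<in> carrier R" "s \<in> S" "r' \<in> carrier R" "s' \<in> S"
  shows "frac r s = frac r' s' \<longleftrightarrow> (\<exists>u\<in>S. u \<otimes> (s' \<otimes> r) = u \<otimes> (s \<otimes> r'))"
proof
  assume "frac r s = frac r' s'"
  moreover have "(r', s') \<in> frac r' s'"
    by (auto simp: mem_frac_iff)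
  ultimately show "\<exists>u\<in>S. u \<otimes> (s' \<otimes> r) = u \<otimes> (s \<otimes> r')"
    by (metis mem_frac_iff)
next
  have trans: "\<exists>w\<in>S. w \<otimes> (z \<otimes> r) = w \<otimes> (s \<otimes> x)"
    if [simp]: "r \<in> carrier R" "r' \<in> carrier R" "x \<in> carrier R" "s \<in> S" "s' \<in> S" "z \<in> S" "u \<in> S" "v \<in> S"
      and u: "u \<otimes> (s' \<otimes> r) = u \<otimes> (s \<otimes> r')" and v: "v \<otimes> (z \<otimes> r') = v \<otimes> (s' \<otimes> x)"
    for r s r' s' x z u v
  proof (rule bexI)
    \<comment> \<open>The multiplier also contains the middle denominator \<open>s'\<close>, so that
      each of the two equations can be applied once.\<close>
    have "(u \<otimes> v \<otimes> s') \<otimes> (z \<otimes> r) = (v \<otimes> z) \<otimes> (u \<otimes> (s' \<otimes> r))"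
      by (simp add: m_ac)
    also have "\<dots> = (u \<otimes> s) \<otimes> (v \<otimes> (z \<otimes> r'))"
      unfolding u by (simp add: m_ac)
    also have "\<dots> = (u \<otimes> v \<otimes> s') \<otimes> (s \<otimes> x)"
      unfolding v by (simp add: m_ac)
    finally show "(u \<otimes> v \<otimes> s') \<otimes> (z \<otimes> r) = (u \<otimes> v \<otimes> s') \<otimes> (s \<otimes> x)" .
  qed simp
  assume "\<exists>u\<in>S. u \<otimes> (s' \<otimes> r) = u \<otimes> (s \<otimes> r')"
  then obtain u where u: "u \<in> S" "u \<otimes> (s' \<otimes> r) = u \<otimes> (s \<otimes> r')"
    by blast
  have "(x, z) \<in> frac r s \<longleftrightarrow> (x, z) \<in> frac r' s'" for x z
  proof
    assume "(x, z) \<in> frac r s"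
    then obtain v where "x \<in> carrier R" "z \<in> S" "v \<in> S" "v \<otimes> (z \<otimes> r) = v \<otimes> (s \<otimes> x)"
      by (auto simp: mem_frac_iff)
    with trans[of r' r x s' s z u v] u show "(x, z) \<in> frac r' s'"
      by (simp add: mem_frac_iff)
  next
    assume "(x, z) \<in> frac r' s'"
    then obtain v where "x \<in> carrier R" "z \<in> S" "v \<in> S" "v \<otimes> (z \<otimes> r') = v \<otimes> (s' \<otimes> x)"
      by (auto simp: mem_frac_iff)
    with trans[of r r' x s s' z u v] u show "(x, z) \<in> frac r s"
      by (simp add: mem_frac_iff)
  qed
  then show "frac r s = frac r' s'"
    by auto
qed

lemma frac_eqI:
  assumes "r \<in> carrier R" "s \<in> S" "r' \<in> carrier R" "s' \<in> S" "s' \<otimes> r = s \<otimes> r'"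
  shows "frac r s = frac r' s'"
  using assms frac_eq_iff by (metis S_one)

lemma carrier_Loc: "carrier Loc = {frac r s | r s. r \<in> carrier R \<and> s \<in> S}"
  by (simp add: localization_def)

lemma frac_closed [simp, intro]: "r \<in> carrier R \<Longrightarrow> s \<in> S \<Longrightarrow> frac r s \<in> carrier Loc"
  by (auto simp: carrier_Loc)

lemma frac_cases:
  assumes "x \<in> carrier Loc"
  obtains r s where "r \<in> carrier R" "s \<in> S" "x = frac r s"
  using assms by (auto simp: carrier_Loc)

lemma one_Loc: "\<one>\<^bsub>Loc\<^esub> = frac \<one> \<one>"
  by (simp add: localization_def)

lemma zero_Loc: "\<zero>\<^bsub>Loc\<^esub> = frac \<zero> \<one>"
  by (simp add: localization_def)

text \<open>The operations of \<open>localization\<close> are unions over all pairs of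
  representatives. Once the result is independent of the representatives, the union collapses,
  because every class contains its own defining pair.\<close>

lemma UN_frac_const:
  assumes "r \<in> carrier R" "s \<in> S" "r' \<in> carrier R" "s' \<in> S"
    and "\<And>x z x' z'. (x, z) \<in> frac r s \<Longrightarrow> (x', z') \<in> frac r' s' \<Longrightarrow> f x z x' z' = c"
  shows "(\<Union>(x, z)\<in>frac r s. \<Union>(x', z')\<in>frac r' s'. f x z x' z') = c"
proof -
  have "(r, s) \<in> frac r s" "(r', s') \<in> frac r' s'"
    using assms by (auto simp: mem_frac_iff)
  with assms(5) show ?thesis
    by (fastforce split: prod.splits)
qed

lemma mult_frac:
  assumes [simp]: "r \<in> carrier R" "s \<in> S" "r' \<in> carrier R" "s' \<in> S"
  shows "frac r s \<otimes>\<^bsub>Loc\<^esub> frac r' s' = frac (r \<otimes> r') (s \<otimes> s')"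
proof -
  have "frac (x \<otimes> x') (z \<otimes> z') = frac (r \<otimes> r') (s \<otimes> s')"
    if "(x, z) \<in> frac r s" "(x', z') \<in> frac r' s'" for x z x' z'
  proof -
    from that obtain u v where [simp]: "x \<in> carrier R" "z \<in> S" "x' \<in> carrier R" "z' \<in> S" "u \<in> S" "v \<in> S"
      and u: "u \<otimes> (z \<otimes> r) = u \<otimes> (s \<otimes> x)" and v: "v \<otimes> (z' \<otimes> r') = v \<otimes> (s' \<otimes> x')"
      by (auto simp: mem_frac_iff)
    have "(u \<otimes> v) \<otimes> ((s \<otimes> s') \<otimes> (x \<otimes> x')) = (u \<otimes> (s \<otimes> x)) \<otimes> (v \<otimes> (s' \<otimes> x'))"
      by (simp add: m_ac)
    also have "\<dots> = (u \<otimes> v) \<otimes> ((z \<otimes> z') \<otimes> (r \<otimes> r'))"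
      unfolding u[symmetric] v[symmetric] by (simp add: m_ac)
    finally show ?thesis
      by (subst frac_eq_iff) (auto intro!: bexI[of _ "u \<otimes> v"])
  qed
  then show ?thesis
    unfolding localization_def by (simp add: UN_frac_const)
qed

lemma add_frac:
  assumes [simp]: "r \<in> carrier R" "s \<in> S" "r' \<in> carrier R" "s' \<in> S"
  shows "frac r s \<oplus>\<^bsub>Loc\<^esub> frac r' s' = frac (s' \<otimes> r \<oplus> s \<otimes> r') (s \<otimes> s')"
proof -
  have "frac (z' \<otimes> x \<oplus> z \<otimes> x') (z \<otimes> z') = frac (s' \<otimes> r \<oplus> s \<otimes> r') (s \<otimes> s')"
    if "(x, z) \<in> frac r s" "(x', z') \<in> frac r' s'" for x z x' z'
  proof -
    from that obtain u v where [simp]: "x \<in> carrier R" "z \<in> S" "x' \<in> carrier R" "z' \<in> S" "u \<in> S" "v \<in> S"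
      and u: "u \<otimes> (z \<otimes> r) = u \<otimes> (s \<otimes> x)" and v: "v \<otimes> (z' \<otimes> r') = v \<otimes> (s' \<otimes> x')"
      by (auto simp: mem_frac_iff)
    have "(u \<otimes> v) \<otimes> ((s \<otimes> s') \<otimes> (z' \<otimes> x \<oplus> z \<otimes> x'))
        = (v \<otimes> s' \<otimes> z') \<otimes> (u \<otimes> (s \<otimes> x)) \<oplus> (u \<otimes> s \<otimes> z) \<otimes> (v \<otimes> (s' \<otimes> x'))"
      by (simp add: m_ac r_distr)
    also have "\<dots> = (u \<otimes> v) \<otimes> ((z \<otimes> z') \<otimes> (s' \<otimes> r \<oplus> s \<otimes> r'))"
      unfolding u[symmetric] v[symmetric] by (simp add: m_ac r_distr)
    finally show ?thesis
      by (subst frac_eq_iff) (auto intro!: bexI[of _ "u \<otimes> v"])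
  qed
  then show ?thesis
    unfolding localization_def by (simp add: UN_frac_const)
qed

lemma Loc_cring: "cring Loc"
proof (rule cringI)
  show "abelian_group Loc"
  proof (rule abelian_groupI)
    fix x y z assume "x \<in> carrier Loc" "y \<in> carrier Loc" "z \<in> carrier Loc"
    then show "x \<oplus>\<^bsub>Loc\<^esub> y \<oplus>\<^bsub>Loc\<^esub> z = x \<oplus>\<^bsub>Loc\<^esub> (y \<oplus>\<^bsub>Loc\<^esub> z)"
      by (elim frac_cases) (simp add: add_frac m_ac a_ac r_distr)
  next
    fix x assume "x \<in> carrier Loc"
    then obtain r s where [simp]: "r \<in> carrier R" "s \<in> S" and x: "x = frac r s"
      by (elim frac_cases)
    show "\<zero>\<^bsub>Loc\<^esub> \<oplus>\<^bsub>Loc\<^esub> x = x"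
      by (simp add: x zero_Loc add_frac)
    show "\<exists>y\<in>carrier Loc. y \<oplus>\<^bsub>Loc\<^esub> x = \<zero>\<^bsub>Loc\<^esub>"
    proof
      show "frac (\<ominus> r) s \<oplus>\<^bsub>Loc\<^esub> x = \<zero>\<^bsub>Loc\<^esub>"
        by (simp add: x zero_Loc add_frac r_minus l_neg frac_eqI)
    qed simp
  qed (auto elim!: frac_cases simp: add_frac zero_Loc m_ac a_ac)
  show "comm_monoid Loc"
    by (rule comm_monoidI) (auto elim!: frac_cases simp: mult_frac one_Loc m_ac)
  fix x y z assume "x \<in> carrier Loc" "y \<in> carrier Loc" "z \<in> carrier Loc"
  then show "(x \<oplus>\<^bsub>Loc\<^esub> y) \<otimes>\<^bsub>Loc\<^esub> z = x \<otimes>\<^bsub>Loc\<^esub> z \<oplus>\<^bsub>Loc\<^esub> y \<otimes>\<^bsub>Loc\<^esub> z"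
    by (elim frac_cases) (simp add: add_frac mult_frac, rule frac_eqI, simp_all add: m_ac l_distr r_distr)
qed

end

section \<open>One-dimensional Cohen--Macaulay local rings\<close>

definition nonzerodivisor :: "('a, 'm) ring_scheme \<Rightarrow> 'a \<Rightarrow> bool"
  where "nonzerodivisor R x \<longleftrightarrow>
    x \<in> carrier R \<and> (\<forall>y\<in>carrier R. x \<otimes>\<^bsub>R\<^esub> y = \<zero>\<^bsub>R\<^esub> \<longrightarrow> y = \<zero>\<^bsub>R\<^esub>)"

definition nilradical :: "('a, 'm) ring_scheme \<Rightarrow> 'a set"
  where "nilradical R = {x \<in> carrier R. \<exists>n::nat. x [^]\<^bsub>R\<^esub> n = \<zero>\<^bsub>R\<^esub>}"

lemma nonzerodivisor_closed: "nonzerodivisor R x \<Longrightarrow> x \<in> carrier R"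
  by (simp add: nonzerodivisor_def)

lemma nonzerodivisorD:
  "nonzerodivisor R x \<Longrightarrow> y \<in> carrier R \<Longrightarrow> x \<otimes>\<^bsub>R\<^esub> y = \<zero>\<^bsub>R\<^esub> \<Longrightarrow> y = \<zero>\<^bsub>R\<^esub>"
  by (simp add: nonzerodivisor_def)

section \<open>Nonzerodivisors and nilpotent elements of a commutative ring\<close>

context cring
begin

lemma nonzerodivisor_pow:
  assumes "nonzerodivisor R x" "y \<in> carrier R" "x [^] (n::nat) \<otimes> y = \<zero>"
  shows "y = \<zero>"
  using assms(3)
proof (induction n)
  case (Suc n)
  have x: "x \<in> carrier R"
    using assms(1) by (rule nonzerodivisor_closed)
  have "x \<otimes> (x [^] n \<otimes> y) = \<zero>"
    using Suc.prems x assms(2) by (simp add: m_ac)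
  then have "x [^] n \<otimes> y = \<zero>"
    by (rule nonzerodivisorD[OF assms(1), rotated]) (simp add: x assms(2))
  then show ?case
    by (rule Suc.IH)
qed (use assms in simp)

lemma nonzerodivisor_not_nilpotent:
  assumes "\<one> \<noteq> \<zero>" "nonzerodivisor R x"
  shows "x \<notin> nilradical R"
  using assms nonzerodivisor_pow[OF assms(2), of \<one>] nonzerodivisor_closed[OF assms(2)]
  by (auto simp: nilradical_def)

lemma nonzerodivisor_mult:
  assumes "nonzerodivisor R x" "nonzerodivisor R y"
  shows "nonzerodivisor R (x \<otimes> y)"
  unfolding nonzerodivisor_def
proof (intro conjI ballI impI)
  note carr = assms[THEN nonzerodivisor_closed]
  then show "x \<otimes> y \<in> carrier R" by simp
  fix z assume z: "z \<in> carrier R" and 0: "x \<otimes> y \<otimes> z = \<zero>"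
  from 0 carr z have "x \<otimes> (y \<otimes> z) = \<zero>" by (simp add: m_assoc)
  then have "y \<otimes> z = \<zero>"
    by (rule nonzerodivisorD[OF assms(1), rotated]) (simp add: carr z)
  then show "z = \<zero>"
    by (rule nonzerodivisorD[OF assms(2) z])
qed

text \<open>If (x + y) z = 0, then x z = - y z. Iterating expresses x^k z as a multiple of y^k z,
  which vanishes for large k, and powers of x can be cancelled.\<close>

lemma nonzerodivisor_add_nilpotent:
  assumes x: "nonzerodivisor R x" and y: "y \<in> nilradical R"
  shows "nonzerodivisor R (x \<oplus> y)"
proof -
  have [simp]: "x \<in> carrier R" "y \<in> carrier R"
    using assms by (auto simp: nonzerodivisor_def nilradical_def)
  obtain n :: nat where n: "y [^] n = \<zero>"
    using y by (auto simp: nilradical_def)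
  have "z = \<zero>" if [simp]: "z \<in> carrier R" and z: "(x \<oplus> y) \<otimes> z = \<zero>" for z
  proof -
    have xz: "x \<otimes> z = \<ominus> (y \<otimes> z)"
      using z by (simp add: l_distr add.inv_equality sum_zero_eq_neg)
    have "\<exists>e\<in>carrier R. x [^] k \<otimes> z = e \<otimes> (y [^] k \<otimes> z)" for k :: nat
    proof (induction k)
      case 0
      then show ?case by (intro bexI[of _ \<one>]) auto
    next
      case (Suc k)
      then obtain e where [simp]: "e \<in> carrier R" and e: "x [^] k \<otimes> z = e \<otimes> (y [^] k \<otimes> z)"
        by blast
      have "x [^] Suc k \<otimes> z = x \<otimes> (x [^] k \<otimes> z)"
        by (simp add: m_ac)
      also have "\<dots> = (e \<otimes> y [^] k) \<otimes> (x \<otimes> z)"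
        unfolding e by (simp add: m_ac)
      also have "\<dots> = \<ominus> e \<otimes> (y [^] Suc k \<otimes> z)"
        unfolding xz by (simp add: m_ac r_minus l_minus)
      finally show ?case by (intro bexI[of _ "\<ominus> e"]) auto
    qed
    then obtain e where "e \<in> carrier R" "x [^] n \<otimes> z = e \<otimes> (y [^] n \<otimes> z)"
      by blast
    then show ?thesis
      using n nonzerodivisor_pow[OF x, of z n] by simp
  qed
  then show ?thesis
    by (simp add: nonzerodivisor_def)
qed

lemma nilradical_mult:
  assumes "x \<in> nilradical R" "r \<in> carrier R"
  shows "r \<otimes> x \<in> nilradical R"
proof -
  obtain n :: nat where "x \<in> carrier R" "x [^] n = \<zero>"
    using assms by (auto simp: nilradical_def)
  then show ?thesis
    using assms(2) by (auto simp: nilradical_def nat_pow_distrib intro!: exI[of _ n])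
qed

lemma genideal_empty: "Idl {} = {\<zero>}"
  using genideal_minimal[OF zeroideal, of "{}"] genideal_ideal[of "{}"]
  by (auto dest: additive_subgroup.zero_closed[OF ideal.axioms(1)])

lemma genideal_singleton: "x \<in> carrier R \<Longrightarrow> Idl {x} = {r \<otimes> x | r. r \<in> carrier R}"
  by (simp flip: cgenideal_eq_genideal add: cgenideal_def)

end

lemma (in primeideal) pow_mem_imp_mem:
  assumes "x \<in> carrier R" "x [^] (n::nat) \<in> I"
  shows "x \<in> I"
  using assms(2)
proof (induction n)
  case 0
  then show ?case using I_notcarr one_imp_carrier by auto
next
  case (Suc n)
  then show ?case using I_prime[of "x [^] n" x] assms(1) by auto
qed

lemma (in primeideal) nilradical_subset: "nilradical R \<subseteq> I"
proof
  fix x assume "x \<in> nilradical R"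
  then obtain n :: nat where "x \<in> carrier R" "x [^] n = \<zero>"
    by (auto simp: nilradical_def)
  then show "x \<in> I"
    using pow_mem_imp_mem[of x n] by simp
qed

text \<open>The conditions are chosen so that depth and dimension can be read off. A nonzerodivisor
  in M makes both at least one; \<open>regular_primary\<close> bounds both by one;
  \<open>nilpotent_or_regular\<close> leaves the nilradical as the only prime besides M.\<close>

locale one_dim_local = cring R for R (structure) +
  fixes M
  assumes M_ideal: "ideal M R"
    and M_proper: "M \<noteq> carrier R"
    and unit_outside: "\<And>x. x \<in> carrier R - M \<Longrightarrow> \<exists>y\<in>carrier R. x \<otimes> y = \<one>"
    and nilpotent_or_regular: "\<And>x. x \<in> carrier R \<Longrightarrow> x \<in> nilradical R \<or> nonzerodivisor R x"
    and regular_in_M: "\<exists>x\<in>M. nonzerodivisor R x"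
    and regular_primary: "\<And>x y. nonzerodivisor R x \<Longrightarrow> y \<in> M \<Longrightarrow> \<exists>n::nat. y [^] n \<in> Idl {x}"
begin

lemma one_notin_M: "\<one> \<notin> M"
  using M_proper ideal.one_imp_carrier[OF M_ideal] by auto

lemma one_not_zero: "\<one> \<noteq> \<zero>"
  using one_notin_M additive_subgroup.zero_closed[OF ideal.axioms(1)[OF M_ideal]] by metis

lemma ideal_subset_M:
  assumes "ideal J R" "J \<noteq> carrier R"
  shows "J \<subseteq> M"
proof
  fix x assume x: "x \<in> J"
  then have xc: "x \<in> carrier R"
    using assms(1) ideal.Icarr by metis
  show "x \<in> M"
  proof (rule ccontr)
    assume "x \<notin> M"
    then obtain y where "y \<in> carrier R" "x \<otimes> y = \<one>"
      using unit_outside xc by blast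
    then have "\<one> \<in> J"
      using ideal.I_r_closed[OF assms(1) x] by metis
    then show False
      using assms ideal.one_imp_carrier by metis
  qed
qed

lemma M_maximal: "maximalideal M R"
proof (rule maximalidealI)
  fix J assume "ideal J R" "M \<subseteq> J" "J \<subseteq> carrier R"
  then show "J = M \<or> J = carrier R"
    using ideal_subset_M by blast
qed (use M_ideal M_proper in auto)

lemma maximalideal_iff: "maximalideal N R \<longleftrightarrow> N = M"
proof
  assume N: "maximalideal N R"
  then interpret N: maximalideal N R .
  have "N \<subseteq> M"
    by (rule ideal_subset_M) (use N.ideal_axioms N.I_notcarr in auto)
  moreover have "M \<subseteq> carrier R"
    using M_ideal ideal.Icarr by fastforce
  ultimately show "N = M"
    using N.I_maximal[OF M_ideal] M_proper by auto
qed (use M_maximal in simp)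

text \<open>The complement of the nilradical is the set of nonzerodivisors. This gives primality,
  and also closure under addition: if x + y were regular with y nilpotent, subtracting y would make
  x regular.\<close>

lemma nilradical_primeideal: "primeideal (nilradical R) R"
proof (rule primeidealI)
  have not_both: "\<not> (x \<in> nilradical R \<and> nonzerodivisor R x)" for x
    using nonzerodivisor_not_nilpotent one_not_zero by blast
  have neg: "\<ominus> x \<in> nilradical R" if "x \<in> nilradical R" for x
    using nilradical_mult[OF that, of "\<ominus> \<one>"] that by (simp add: nilradical_def l_minus)
  have add: "x \<oplus> y \<in> nilradical R" if x: "x \<in> nilradical R" and y: "y \<in> nilradical R" for x y
  proof (rule ccontr)
    have [simp]: "x \<in> carrier R" "y \<in> carrier R"
      using x y by (auto simp: nilradical_def)
    assume "x \<oplus> y \<notin> nilradical R"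
    then have "nonzerodivisor R (x \<oplus> y \<oplus> \<ominus> y)"
      using nilpotent_or_regular[of "x \<oplus> y"] nonzerodivisor_add_nilpotent[OF _ neg[OF y]] by simp
    then show False
      using x not_both by (simp add: a_assoc r_neg)
  qed
  show ideal: "ideal (nilradical R) R"
  proof (rule idealI)
    show "subgroup (nilradical R) (add_monoid R)"
      by (rule subgroup.intro)
        (use neg add in \<open>auto simp: nilradical_def simp flip: a_inv_def intro: exI[of _ "1::nat"]\<close>)
    show "a \<otimes> x \<in> nilradical R" "x \<otimes> a \<in> nilradical R" if "x \<in> carrier R" "a \<in> nilradical R" for x a
      using nilradical_mult that by (auto simp: m_comm nilradical_def)
  qed (rule ring_axioms)
  have "\<one> \<notin> nilradical R"
    by (simp add: nilradical_def one_not_zero)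
  then show "carrier R \<noteq> nilradical R"
    by (metis one_closed)
  show "a \<in> nilradical R \<or> b \<in> nilradical R"
    if "a \<in> carrier R" "b \<in> carrier R" "a \<otimes> b \<in> nilradical R" for a b
    using nonzerodivisor_mult nilpotent_or_regular that not_both by blast
qed (rule is_cring)

text \<open>A prime with a nonzerodivisor contains M by \<open>regular_primary\<close>, and lies in
  M because every element outside M is a unit. A prime without one consists of nilpotents.\<close>

lemma primeideal_cases:
  assumes "primeideal P R"
  shows "P = nilradical R \<or> P = M"
proof -
  interpret P: primeideal P R by fact
  have PM: "P \<subseteq> M"
    by (rule ideal_subset_M) (use P.ideal_axioms P.I_notcarr in auto)
  show ?thesis
  proof (cases "\<exists>x\<in>P. nonzerodivisor R x")
    case True
    then obtain x where x: "x \<in> P" "nonzerodivisor R x"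
      by blast
    have "y \<in> P" if y: "y \<in> M" for y
    proof -
      obtain n :: nat where "y [^] n \<in> Idl {x}"
        using regular_primary[OF x(2) y] by blast
      then have "y [^] n \<in> P"
        using genideal_minimal[OF P.ideal_axioms] x by blast
      then show ?thesis
        using P.pow_mem_imp_mem ideal.Icarr[OF M_ideal y] by blast
    qed
    with PM show ?thesis by auto
  next
    case False
    then show ?thesis
      using nilpotent_or_regular P.nilradical_subset P.Icarr by blast
  qed
qed

lemma krull_dim_eq_1: "krull_dim R = 1"
  unfolding krull_dim_def
proof (rule antisym)
  show "Sup {enat n | n. \<exists>P. (\<forall>i\<le>n. primeideal (P i) R) \<and> (\<forall>i<n. P i \<subset> P (Suc i))} \<le> 1"
  proof (rule Sup_least, safe)
    fix n and P :: "nat \<Rightarrow> 'a set"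
    assume P: "\<forall>i\<le>n. primeideal (P i) R" "\<forall>i<n. P i \<subset> P (Suc i)"
    have "n \<le> 1"
    proof (rule ccontr)
      assume n: "\<not> n \<le> 1"
      then have "P 0 \<subset> P (Suc 0)" "P (Suc 0) \<subset> P (Suc (Suc 0))"
        using P by auto
      moreover have "P 0 = nilradical R \<or> P 0 = M" "P (Suc 0) = nilradical R \<or> P (Suc 0) = M"
          "P (Suc (Suc 0)) = nilradical R \<or> P (Suc (Suc 0)) = M"
        using P n by (auto intro!: primeideal_cases)
      ultimately show False by auto
    qed
    then show "enat n \<le> 1"
      by (simp add: one_enat_def)
  qed
  have M: "primeideal M R"
    using M_maximal maximalideal_prime by blast
  then interpret M: primeideal M R .
  have "nilradical R \<subseteq> M"
    by (rule M.nilradical_subset)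
  moreover have "nilradical R \<noteq> M"
    using regular_in_M nonzerodivisor_not_nilpotent one_not_zero by blast
  ultimately have "\<exists>P. (\<forall>i\<le>1. primeideal (P i) R) \<and> (\<forall>i<1. P i \<subset> P (Suc i))"
    using M nilradical_primeideal
    by (intro exI[of _ "\<lambda>i::nat. if i = 0 then nilradical R else M"]) auto
  then show "1 \<le> Sup {enat n | n. \<exists>P. (\<forall>i\<le>n. primeideal (P i) R) \<and> (\<forall>i<n. P i \<subset> P (Suc i))}"
    by (intro Sup_upper) (auto simp: one_enat_def)
qed

lemma depth_eq_1: "depth R M = 1"
  unfolding depth_def
proof (rule antisym)
  show "Sup {enat (length xs) | xs. set xs \<subseteq> M \<and> regular_sequence R xs} \<le> 1"
  proof (rule Sup_least, safe)
    fix xs assume M: "set xs \<subseteq> M" and reg: "regular_sequence R xs"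
    have "length xs \<le> 1"
    proof (rule ccontr)
      assume "\<not> length xs \<le> 1"
      then obtain x y ys where xs: "xs = x # y # ys"
        by (metis One_nat_def Suc_le_mono le0 length_Cons list.exhaust list.size(3))
      have carr: "x \<in> carrier R" "y \<in> carrier R"
        using reg by (auto simp: regular_sequence_def xs)
      have x: "nonzerodivisor R x"
        using reg[unfolded regular_sequence_def, THEN conjunct2, THEN conjunct2, rule_format, of 0] carr
        by (auto simp: nonzerodivisor_def xs genideal_empty)
      have y: "r \<in> Idl {x}" if "r \<in> carrier R" "y \<otimes> r \<in> Idl {x}" for r
        using reg[unfolded regular_sequence_def, THEN conjunct2, THEN conjunct2, rule_format, of 1 r] that
        by (auto simp: xs)
      \<comment> \<open>Being regular modulo (x), y can be cancelled from y^n \<in> (x) until 1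
        \<in> (x), which contradicts properness of the sequence.\<close>
      obtain n :: nat where "y [^] n \<in> Idl {x}"
        using regular_primary[OF x] M xs by auto
      then have "\<one> \<in> Idl {x}"
      proof (induction n)
        case (Suc n)
        then show ?case using y[of "y [^] n"] carr by (simp add: m_comm)
      qed simp
      moreover have "Idl {x} \<subseteq> Idl (set xs)"
        by (rule genideal_minimal) (use genideal_ideal[of "set xs"] genideal_self[of "set xs"] M ideal.Icarr[OF M_ideal] in \<open>auto simp: xs\<close>)
      ultimately have "\<one> \<in> Idl (set xs)" by blast
      moreover have "ideal (Idl (set xs)) R"
        by (rule genideal_ideal) (use M ideal.Icarr[OF M_ideal] in auto)
      ultimately show False
        using reg ideal.one_imp_carrier by (auto simp: regular_sequence_def)
    qed
    then show "enat (length xs) \<le> 1"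
      by (simp add: one_enat_def)
  qed
  obtain x where x: "x \<in> M" "nonzerodivisor R x"
    using regular_in_M by blast
  have xc: "x \<in> carrier R"
    using x(2) by (rule nonzerodivisor_closed)
  have "Idl {x} \<subseteq> M"
    using genideal_minimal[OF M_ideal] x by blast
  then have "\<one> \<notin> Idl {x}"
    using one_notin_M by blast
  then have "Idl {x} \<noteq> carrier R" by auto
  then have "regular_sequence R [x]"
    using xc x(2) by (auto simp: regular_sequence_def genideal_empty nonzerodivisor_def)
  then show "1 \<le> Sup {enat (length xs) | xs. set xs \<subseteq> M \<and> regular_sequence R xs}"
    using x by (intro Sup_upper) (auto simp: one_enat_def intro!: exI[of _ "[x]"])
qed

lemma cohen_macaulay_local:
  assumes "noetherian_ring R"
  shows "cohen_macaulay_local_ring R"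
  unfolding cohen_macaulay_local_ring_def
  using assms is_cring maximalideal_iff depth_eq_1 krull_dim_eq_1 by auto

end

section \<open>Ideals, nilpotents and nonzerodivisors in a localization\<close>

context localization_at
begin

sublocale Loc: cring Loc
  by (rule Loc_cring)

lemma frac_pow:
  assumes "r \<in> carrier R" "s \<in> S"
  shows "frac r s [^]\<^bsub>Loc\<^esub> (n::nat) = frac (r [^] n) (s [^] n)" "s [^] n \<in> S"
proof (induction n)
  case (Suc n)
  case 1
  show ?case using Suc assms by (simp add: mult_frac)
  case 2
  show ?case using Suc assms by simp
qed (auto simp: one_Loc)

lemma frac_eq_zero_iff:
  assumes [simp]: "r \<in> carrier R" "s \<in> S"
  shows "frac r s = \<zero>\<^bsub>Loc\<^esub> \<longleftrightarrow> (\<exists>u\<in>S. u \<otimes> r = \<zero>)"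
  by (simp add: zero_Loc frac_eq_iff)

lemma frac_self:
  assumes [simp]: "s \<in> S"
  shows "frac s s = \<one>\<^bsub>Loc\<^esub>"
  unfolding one_Loc by (rule frac_eqI) simp_all

lemma frac_mem_ideal_iff:
  assumes J: "ideal J Loc" and [simp]: "r \<in> carrier R" "s \<in> S"
  shows "frac r s \<in> J \<longleftrightarrow> frac r \<one> \<in> J"
proof
  have "frac r \<one> = frac s \<one> \<otimes>\<^bsub>Loc\<^esub> frac r s"
    by (simp add: mult_frac) (rule frac_eqI; simp)
  then show "frac r s \<in> J \<Longrightarrow> frac r \<one> \<in> J"
    using ideal.I_l_closed[OF J] by simp
  have "frac r s = frac \<one> s \<otimes>\<^bsub>Loc\<^esub> frac r \<one>"
    by (simp add: mult_frac)
  then show "frac r \<one> \<in> J \<Longrightarrow> frac r s \<in> J"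
    using ideal.I_l_closed[OF J] by simp
qed

lemma contraction_ideal:
  assumes J: "ideal J Loc"
  shows "ideal {r \<in> carrier R. frac r \<one> \<in> J} R"
proof (rule idealI)
  interpret J: ideal J Loc by fact
  have add: "frac (r \<oplus> r') \<one> \<in> J" if "r \<in> carrier R" "r' \<in> carrier R" "frac r \<one> \<in> J" "frac r' \<one> \<in> J" for r r'
    using J.a_closed[of "frac r \<one>" "frac r' \<one>"] that by (simp add: add_frac)
  have mult: "frac (x \<otimes> r) \<one> \<in> J" if "r \<in> carrier R" "x \<in> carrier R" "frac r \<one> \<in> J" for r x
    using J.I_l_closed[of "frac r \<one>" "frac x \<one>"] that by (simp add: mult_frac)
  show "subgroup {r \<in> carrier R. frac r \<one> \<in> J} (add_monoid R)"
  proof (rule subgroup.intro)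
    fix x assume "x \<in> {r \<in> carrier R. frac r \<one> \<in> J}"
    then show "inv\<^bsub>add_monoid R\<^esub> x \<in> {r \<in> carrier R. frac r \<one> \<in> J}"
      using mult[of x "\<ominus> \<one>"] by (simp add: l_minus flip: a_inv_def)
  qed (use add J.zero_closed in \<open>auto simp: zero_Loc\<close>)
  show "x \<otimes> a \<in> {r \<in> carrier R. frac r \<one> \<in> J}" "a \<otimes> x \<in> {r \<in> carrier R. frac r \<one> \<in> J}"
    if "a \<in> {r \<in> carrier R. frac r \<one> \<in> J}" "x \<in> carrier R" for a x
    using mult that by (auto simp: m_comm)
qed (rule ring_axioms)

text \<open>Denominators are units, so an ideal of the localization is generated by the image of its
  contraction. Finitely many generators of the contraction therefore suffice.\<close>

lemma noetherian_Loc: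
  assumes "noetherian_ring R"
  shows "noetherian_ring Loc"
proof (rule Loc.noetherian_ringI)
  fix J assume J: "ideal J Loc"
  define C where "C = {r \<in> carrier R. frac r \<one> \<in> J}"
  obtain B where B: "B \<subseteq> carrier R" "finite B" "C = Idl B"
    using noetherian_ring.finetely_gen[OF assms contraction_ideal[OF J]] unfolding C_def by blast
  let ?B = "(\<lambda>r. frac r \<one>) ` B"
  have Bc: "?B \<subseteq> carrier Loc"
    using B by auto
  have "?B \<subseteq> J"
    using genideal_self[OF B(1)] B(3) by (auto simp: C_def)
  then have "Idl\<^bsub>Loc\<^esub> ?B \<subseteq> J"
    by (rule Loc.genideal_minimal[OF J])
  moreover have "J \<subseteq> Idl\<^bsub>Loc\<^esub> ?B"
  proof
    fix x assume x: "x \<in> J"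
    then have "x \<in> carrier Loc"
      by (rule ideal.Icarr[OF J])
    then obtain r s where rs: "r \<in> carrier R" "s \<in> S" "x = frac r s"
      by (elim frac_cases)
    have I: "ideal (Idl\<^bsub>Loc\<^esub> ?B) Loc"
      by (rule Loc.genideal_ideal[OF Bc])
    have "r \<in> Idl B"
      using x rs(3) frac_mem_ideal_iff[OF J rs(1,2)] rs(1) unfolding B(3)[symmetric] C_def by simp
    also have "Idl B \<subseteq> {r \<in> carrier R. frac r \<one> \<in> Idl\<^bsub>Loc\<^esub> ?B}"
      by (rule genideal_minimal[OF contraction_ideal[OF I]])
        (use B(1) subsetD[OF Loc.genideal_self[OF Bc]] in blast)
    finally show "x \<in> Idl\<^bsub>Loc\<^esub> ?B"
      using frac_mem_ideal_iff[OF I rs(1,2)] rs(3) by simp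
  qed
  ultimately show "\<exists>A\<subseteq>carrier Loc. finite A \<and> J = Idl\<^bsub>Loc\<^esub> A"
    using Bc B(2) by (intro exI[of _ ?B]) auto
qed

lemma nilradical_frac:
  assumes "r \<in> nilradical R" "s \<in> S"
  shows "frac r s \<in> nilradical Loc"
proof -
  obtain n :: nat where "r \<in> carrier R" "r [^] n = \<zero>"
    using assms by (auto simp: nilradical_def)
  then have "frac r s [^]\<^bsub>Loc\<^esub> n = \<zero>\<^bsub>Loc\<^esub>"
    using frac_pow[of r s n] assms(2) by (auto simp: frac_eq_zero_iff intro!: bexI[of _ \<one>])
  then show ?thesis
    using \<open>r \<in> carrier R\<close> assms(2) by (auto simp: nilradical_def)
qed

lemma nonzerodivisor_frac:
  assumes r: "nonzerodivisor R r" and s [simp]: "s \<in> S"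
  shows "nonzerodivisor Loc (frac r s)"
  unfolding nonzerodivisor_def
proof (intro conjI ballI impI)
  have [simp]: "r \<in> carrier R"
    using r by (rule nonzerodivisor_closed)
  show "frac r s \<in> carrier Loc" by simp
  fix y assume "y \<in> carrier Loc" and 0: "frac r s \<otimes>\<^bsub>Loc\<^esub> y = \<zero>\<^bsub>Loc\<^esub>"
  then obtain r' s' where [simp]: "r' \<in> carrier R" "s' \<in> S" and y: "y = frac r' s'"
    by (elim frac_cases)
  obtain u where u: "u \<in> S" "u \<otimes> (r \<otimes> r') = \<zero>"
    using 0 by (auto simp: y mult_frac frac_eq_zero_iff)
  then have "r \<otimes> (u \<otimes> r') = \<zero>"
    by (simp add: m_ac)
  then have "u \<otimes> r' = \<zero>"
    by (rule nonzerodivisorD[OF r, rotated]) (simp add: u)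
  then show "y = \<zero>\<^bsub>Loc\<^esub>"
    using u(1) by (auto simp: y frac_eq_zero_iff)
qed

end

text \<open>In R itself no power of y need be a multiple of x, since x may lie in primes that do not
  contain y. The factor c outside M accounts for those primes and becomes a unit in the
  localization.\<close>

lemma (in cring) localization_one_dim_local:
  assumes M: "primeideal M R"
    and nilpotent_or_regular: "\<And>x. x \<in> carrier R \<Longrightarrow> x \<in> nilradical R \<or> nonzerodivisor R x"
    and regular: "\<exists>x\<in>M. nonzerodivisor R x"
    and primary: "\<And>x y. nonzerodivisor R x \<Longrightarrow> y \<in> M \<Longrightarrow>
      \<exists>c\<in>carrier R - M. \<exists>n::nat. c \<otimes> y [^] n \<in> Idl {x}"
  shows "one_dim_local (localization R (carrier R - M))
           {frac_class R (carrier R - M) r s | r s. r \<in> M \<and> s \<in> carrier R - M}"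
proof -
  interpret M: primeideal M R by fact
  have one_M: "\<one> \<notin> M"
    using M.I_notcarr M.one_imp_carrier by auto
  interpret localization_at R "carrier R - M"
  proof unfold_locales
    show "x \<otimes> y \<in> carrier R - M" if "x \<in> carrier R - M" "y \<in> carrier R - M" for x y
      using M.I_prime[of x y] that by auto
  qed (use one_M in auto)
  let ?S = "carrier R - M" and ?M = "{frac r s | r s. r \<in> M \<and> s \<in> carrier R - M}"
  \<comment> \<open>Membership in \<open>?M\<close> does not depend on the representative: u and
    \<open>s'\<close> lie outside the prime M and can be removed.\<close>
  have frac_in_M: "r \<in> M" if rs: "r \<in> carrier R" "s \<in> ?S" "frac r s \<in> ?M" for r s
  proof -
    obtain r' s' where r': "r' \<in> M" "s' \<in> ?S" "frac r s = frac r' s'"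
      using rs(3) by auto
    then obtain u where u: "u \<in> ?S" "u \<otimes> (s' \<otimes> r) = u \<otimes> (s \<otimes> r')"
      using rs(1,2) frac_eq_iff[of r s r' s'] M.Icarr by auto
    have "u \<otimes> (s \<otimes> r') \<in> M"
      using r' u(1) rs M.I_l_closed by auto
    with u have "u \<otimes> (s' \<otimes> r) \<in> M" by simp
    then have "s' \<otimes> r \<in> M"
      using M.I_prime[of u "s' \<otimes> r"] u(1) r' rs(1) by auto
    then show ?thesis
      using M.I_prime[of s' r] r' rs(1) by auto
  qed
  show ?thesis
  proof (intro one_dim_local.intro one_dim_local_axioms.intro)
    show "cring Loc" by (rule Loc_cring)
    show ideal: "ideal ?M Loc"
    proof (rule idealI)
      have add: "x \<oplus>\<^bsub>Loc\<^esub> y \<in> ?M" if xy: "x \<in> ?M" "y \<in> ?M" for x y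
      proof -
        obtain r s r' s' where rs: "r \<in> M" "s \<in> ?S" "x = frac r s" "r' \<in> M" "s' \<in> ?S" "y = frac r' s'"
          using xy by blast
        then have "x \<oplus>\<^bsub>Loc\<^esub> y = frac (s' \<otimes> r \<oplus> s \<otimes> r') (s \<otimes> s')"
          by (simp add: add_frac M.Icarr)
        moreover have "s' \<otimes> r \<oplus> s \<otimes> r' \<in> M"
          using rs by (intro M.a_closed M.I_l_closed) auto
        moreover have "s \<otimes> s' \<in> ?S"
          using rs by (intro S_mult)
        ultimately show ?thesis by blast
      qed
      have mult: "y \<otimes>\<^bsub>Loc\<^esub> x \<in> ?M" if xy: "x \<in> ?M" "y \<in> carrier Loc" for x y
      proof -
        obtain r s where rs: "r \<in> M" "s \<in> ?S" "x = frac r s"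
          using xy(1) by blast
        obtain r' s' where rs': "r' \<in> carrier R" "s' \<in> ?S" "y = frac r' s'"
          using xy(2) by (rule frac_cases)
        note rs = rs rs'
        then have "y \<otimes>\<^bsub>Loc\<^esub> x = frac (r' \<otimes> r) (s' \<otimes> s)"
          by (simp add: mult_frac M.Icarr)
        moreover have "r' \<otimes> r \<in> M"
          using rs by (intro M.I_l_closed) auto
        moreover have "s' \<otimes> s \<in> ?S"
          using rs by (intro S_mult)
        ultimately show ?thesis by blast
      qed
      have sub: "?M \<subseteq> carrier Loc"
        using M.Icarr by auto
      show "subgroup ?M (add_monoid Loc)"
      proof (rule subgroup.intro)
        show "\<one>\<^bsub>add_monoid Loc\<^esub> \<in> ?M"
          unfolding monoid.simps zero_Loc using one_M M.zero_closed by blast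
        fix x assume x: "x \<in> ?M"
        then have "\<ominus>\<^bsub>Loc\<^esub> \<one>\<^bsub>Loc\<^esub> \<otimes>\<^bsub>Loc\<^esub> x \<in> ?M"
          using mult by blast
        moreover have "x \<in> carrier Loc"
          using x sub by blast
        ultimately have "\<ominus>\<^bsub>Loc\<^esub> x \<in> ?M"
          by (simp add: Loc.l_minus)
        then show "inv\<^bsub>add_monoid Loc\<^esub> x \<in> ?M"
          unfolding a_inv_def .
      qed (use sub add in auto)
      show "x \<otimes>\<^bsub>Loc\<^esub> y \<in> ?M" "y \<otimes>\<^bsub>Loc\<^esub> x \<in> ?M" if "x \<in> ?M" "y \<in> carrier Loc" for x y
        using mult[OF that] Loc.m_comm[OF subsetD[OF sub that(1)] that(2)] by simp_all
    qed (rule Loc.ring_axioms)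
    have one_notin: "\<one>\<^bsub>Loc\<^esub> \<notin> ?M"
      unfolding one_Loc using frac_in_M[OF one_closed S_one] one_M by blast
    then show "?M \<noteq> carrier Loc"
      using Loc.one_closed by blast
    have zero_in: "\<zero>\<^bsub>Loc\<^esub> \<in> ?M"
      by (rule additive_subgroup.zero_closed[OF ideal.axioms(1)[OF ideal]])
    have one_not_zero: "\<one>\<^bsub>Loc\<^esub> \<noteq> \<zero>\<^bsub>Loc\<^esub>"
    proof
      assume "\<one>\<^bsub>Loc\<^esub> = \<zero>\<^bsub>Loc\<^esub>"
      from one_notin[unfolded this] zero_in show False by contradiction
    qed
    fix x
    {
      assume x: "x \<in> carrier Loc"
      then obtain r s where rs: "r \<in> carrier R" "s \<in> ?S" "x = frac r s"
        by (elim frac_cases)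
      then show "x \<in> nilradical Loc \<or> nonzerodivisor Loc x"
        using nilpotent_or_regular[OF rs(1)] nilradical_frac[OF _ rs(2), of r] nonzerodivisor_frac[OF _ rs(2), of r]
        by metis
    }
    {
      assume x: "x \<in> carrier Loc - ?M"
      then have "x \<in> carrier Loc" by simp
      then obtain r s where rs: "r \<in> carrier R" "s \<in> ?S" "x = frac r s"
        by (rule frac_cases)
      then have r: "r \<in> ?S"
        using x by blast
      have "x \<otimes>\<^bsub>Loc\<^esub> frac s r = \<one>\<^bsub>Loc\<^esub>"
        using rs r frac_self[of "r \<otimes> s"] S_mult[of r s] by (simp add: mult_frac m_comm)
      then show "\<exists>y\<in>carrier Loc. x \<otimes>\<^bsub>Loc\<^esub> y = \<one>\<^bsub>Loc\<^esub>"
        using rs r by blast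
    }
    {
      fix y assume x: "nonzerodivisor Loc x" and "y \<in> ?M"
      then obtain m t where mt: "m \<in> M" "t \<in> ?S" "y = frac m t"
        by blast
      obtain r s where rs: "r \<in> carrier R" "s \<in> ?S" "x = frac r s"
        using nonzerodivisor_closed[OF x] by (rule frac_cases)
      \<comment> \<open>A regular fraction need not have a regular numerator in general. Here the
        dichotomy in R forces it, since a nilpotent r would make x nilpotent.\<close>
      have "r \<notin> nilradical R"
        using Loc.nonzerodivisor_not_nilpotent[OF one_not_zero x] nilradical_frac rs(2,3) by blast
      then have "nonzerodivisor R r"
        using nilpotent_or_regular rs by blast
      then obtain c n where c: "c \<in> ?S" "c \<otimes> m [^] (n::nat) \<in> Idl {r}"
        using primary mt(1) by blast
      then obtain w where w: "w \<in> carrier R" "c \<otimes> m [^] n = w \<otimes> r"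
        using rs(1) by (auto simp: genideal_singleton)
      have t: "t [^] n \<in> ?S"
        using frac_pow(2)[of m t n] mt M.Icarr by blast
      have m: "m \<in> carrier R"
        using mt M.Icarr by blast
      have "y [^]\<^bsub>Loc\<^esub> n = frac (m [^] n) (t [^] n)"
        unfolding mt(3) by (rule frac_pow(1)[OF m mt(2)])
      \<comment> \<open>From c m^n = w r one gets m^n / t^n = w r / (c t^n); replacing r by s x
        produces this cofactor.\<close>
      also have "\<dots> = frac (w \<otimes> s) (c \<otimes> t [^] n) \<otimes>\<^bsub>Loc\<^esub> x"
      proof -
        have "(c \<otimes> t [^] n \<otimes> s) \<otimes> m [^] n = (t [^] n \<otimes> s) \<otimes> (c \<otimes> m [^] n)"
          using c(1) rs(2) m t by (simp add: m_ac)
        also have "\<dots> = t [^] n \<otimes> (w \<otimes> s \<otimes> r)"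
          unfolding w(2) using c(1) rs(1,2) m t w(1) by (simp add: m_ac)
        finally have eq: "(c \<otimes> t [^] n \<otimes> s) \<otimes> m [^] n = t [^] n \<otimes> (w \<otimes> s \<otimes> r)" .
        have "frac (w \<otimes> s) (c \<otimes> t [^] n) \<otimes>\<^bsub>Loc\<^esub> x = frac (w \<otimes> s \<otimes> r) (c \<otimes> t [^] n \<otimes> s)"
          unfolding rs(3) using rs(1,2) w(1) S_closed[OF rs(2)] by (intro mult_frac S_mult c(1) t m_closed)
        also have "\<dots> = frac (m [^] n) (t [^] n)"
          by (rule frac_eqI[OF _ S_mult[OF S_mult[OF c(1) t] rs(2)] _ t eq[symmetric]])
            (simp_all add: rs(1) w(1) m S_closed[OF rs(2)])
        finally show ?thesis ..
      qed
      also have "\<dots> \<in> Idl\<^bsub>Loc\<^esub> {x}"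
      proof -
        have "frac (w \<otimes> s) (c \<otimes> t [^] n) \<in> carrier Loc"
          by (rule frac_closed[OF m_closed[OF w(1) S_closed[OF rs(2)]] S_mult[OF c(1) t]])
        then show ?thesis
          unfolding Loc.genideal_singleton[OF nonzerodivisor_closed[OF x]] by blast
      qed
      finally show "\<exists>n::nat. y [^]\<^bsub>Loc\<^esub> n \<in> Idl\<^bsub>Loc\<^esub> {x}" ..
    }
    obtain x where "x \<in> M" "nonzerodivisor R x"
      using regular by blast
    then show "\<exists>x\<in>?M. nonzerodivisor Loc x"
      using nonzerodivisor_frac[of x \<one>] S_one by blast
  qed
qed

text \<open>Split a factor p off d as long as the remaining cofactor lies in J. The degree drops
  each time, so the process stops at a cofactor outside J. Lifted to R, it becomes the factor c
  outside M in the localization criterion.\<close>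

lemma poly_ideal_quotient_power:
  fixes J :: "'k::field poly set" and p d :: "'k poly"
  assumes p: "\<not> is_unit p" "p \<noteq> 0" and J: "\<And>f. f \<in> J \<Longrightarrow> p dvd f" and "d \<noteq> 0"
  shows "\<exists>e n. e \<notin> J \<and> d dvd e * p ^ n"
  using \<open>d \<noteq> 0\<close>
proof (induction "degree d" arbitrary: d rule: less_induct)
  case less
  show ?case
  proof (cases "d \<in> J")
    case True
    then obtain d' where d: "d = p * d'"
      using J by blast
    with less.prems have "d' \<noteq> 0" by auto
    moreover have "degree d' < degree d"
      using p \<open>d' \<noteq> 0\<close> by (simp add: d degree_mult_eq is_unit_iff_degree)
    ultimately obtain e n where "e \<notin> J" "d' dvd e * p ^ n"
      using less.hyps by blast
    then have "d dvd e * p ^ Suc n"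
      by (simp add: d mult.left_commute mult_dvd_mono)
    with \<open>e \<notin> J\<close> show ?thesis by blast
  next
    case False
    then show ?thesis
      by (intro exI[of _ d] exI[of _ 0]) simp
  qed
qed

text \<open>J is a plain set with closure properties because it occurs both as the image of a
  maximal ideal and as the set of coefficients at one generator of a module. The zero ideal is
  included, with p = 0.\<close>

lemma poly_submodule_principal:
  fixes J :: "'k::field poly set"
  assumes zero: "0 \<in> J" and add: "\<And>f g. f \<in> J \<Longrightarrow> g \<in> J \<Longrightarrow> f + g \<in> J"
    and mult: "\<And>f g. f \<in> J \<Longrightarrow> g * f \<in> J"
  obtains p where "p \<in> J" "\<And>f. f \<in> J \<Longrightarrow> p dvd f"
proof (cases "J = {0}")
  case False
  then obtain q where "q \<in> J" "q \<noteq> 0"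
    using zero by blast
  then obtain p where p: "p \<in> J" "p \<noteq> 0" and least: "\<And>f. f \<in> J \<Longrightarrow> f \<noteq> 0 \<Longrightarrow> degree p \<le> degree f"
    using ex_has_least_nat[of "\<lambda>f. f \<in> J \<and> f \<noteq> 0" q degree] by blast
  show thesis
  proof
    fix f assume f: "f \<in> J"
    have "f mod p = f + (- (f div p)) * p"
      by (simp add: minus_div_mult_eq_mod[symmetric])
    also have "\<dots> \<in> J"
      using f p by (intro add mult)
    finally have "f mod p = 0"
      using least[of "f mod p"] degree_mod_less[OF p(2), of f] by fastforce
    then show "p dvd f" by auto
  qed (rule p)
qed (use that[of 0] in auto)

text \<open>The kernel of \<phi> is nil, so every prime of R contains it and corresponds to a prime
  of k[X]. A maximal ideal M is the preimage of some (p) with p nonzero, and a lift of p is the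
  nonzerodivisor in M that gives depth one.\<close>

theorem (in cring) cohen_macaulay_poly_quotient:
  fixes \<phi> :: "'a \<Rightarrow> 'k::field poly"
  assumes noetherian: "noetherian_ring R"
    and add: "\<And>x y. x \<in> carrier R \<Longrightarrow> y \<in> carrier R \<Longrightarrow> \<phi> (x \<oplus> y) = \<phi> x + \<phi> y"
    and mult: "\<And>x y. x \<in> carrier R \<Longrightarrow> y \<in> carrier R \<Longrightarrow> \<phi> (x \<otimes> y) = \<phi> x * \<phi> y"
    and one: "\<phi> \<one> = 1"
    and surj: "\<And>p. \<exists>x\<in>carrier R. \<phi> x = p"
    and nilpotent: "\<And>x. x \<in> carrier R \<Longrightarrow> \<phi> x = 0 \<Longrightarrow> x \<in> nilradical R"
    and regular: "\<And>x. x \<in> carrier R \<Longrightarrow> \<phi> x \<noteq> 0 \<Longrightarrow> nonzerodivisor R x"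
  shows "cohen_macaulay_ring R"
  unfolding cohen_macaulay_ring_def
proof (intro conjI allI impI)
  fix M assume "maximalideal M R"
  then interpret M: maximalideal M R .
  have prime: "primeideal M R"
    by (rule maximalideal_prime) (rule M.maximalideal_axioms)
  then interpret M: primeideal M R .
  have pow: "\<phi> (x [^] n) = \<phi> x ^ n" if "x \<in> carrier R" for x and n :: nat
    by (induction n) (use that in \<open>simp_all add: one mult mult.commute\<close>)
  have zero: "\<phi> \<zero> = 0"
    by (metis add add_cancel_right_right zero_closed l_zero)
  have minus: "\<phi> (\<ominus> x) = - \<phi> x" if "x \<in> carrier R" for x
    using add[of x "\<ominus> x"] that zero by (simp add: r_neg eq_neg_iff_add_eq_0 add.commute)
  define J where "J = \<phi> ` M"
  \<comment> \<open>M contains the nilradical and hence the kernel of \<phi>, so M is the full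
    preimage of J.\<close>
  have mem_M: "x \<in> M" if x: "x \<in> carrier R" "\<phi> x \<in> J" for x
  proof -
    obtain y where y: "y \<in> M" "\<phi> x = \<phi> y"
      using x by (auto simp: J_def)
    then have "x \<ominus> y \<in> nilradical R"
      using x M.Icarr by (intro nilpotent) (auto simp: a_minus_def add minus)
    then have "x \<ominus> y \<oplus> y \<in> M"
      using M.nilradical_subset y by (intro M.a_closed) auto
    then show ?thesis
      using x(1) M.Icarr[OF y(1)] by (simp add: a_minus_def a_assoc l_neg)
  qed
  have "\<exists>x\<in>carrier R. \<phi> x = f \<and> (f \<in> J \<longrightarrow> x \<in> M)" for f
    using surj mem_M by metis
  then obtain lift where lift: "\<And>f. lift f \<in> carrier R" "\<And>f. \<phi> (lift f) = f" "\<And>f. f \<in> J \<Longrightarrow> lift f \<in> M"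
    by metis
  have Jadd: "f + g \<in> J" if "f \<in> J" "g \<in> J" for f g
    using that M.a_closed M.Icarr by (fastforce simp: J_def simp flip: add)
  have Jmult: "g * f \<in> J" if f: "f \<in> J" for f g
  proof -
    have "lift g \<otimes> lift f \<in> M"
      using lift f by (intro M.I_l_closed) auto
    then have "\<phi> (lift g \<otimes> lift f) \<in> J"
      by (simp add: J_def)
    then show ?thesis
      by (simp add: mult lift)
  qed
  have one_J: "1 \<notin> J"
    using mem_M[of \<one>] one M.I_notcarr M.one_imp_carrier by auto
  have "0 \<in> J"
    using zero M.zero_closed by (force simp: J_def)
  then obtain p where p: "p \<in> J" "\<And>f. f \<in> J \<Longrightarrow> p dvd f"
    using poly_submodule_principal Jadd Jmult by metis
  have p_unit: "\<not> is_unit p"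
    using one_J Jmult[OF p(1)] by (metis dvdE mult.commute)
  \<comment> \<open>If p were 0, then M would map to 0; adjoining a lift of X to M would give the
    unit ideal by maximality, and X would be a unit of k[X].\<close>
  have p_nonzero: "p \<noteq> 0"
  proof
    assume "p = 0"
    then have J0: "J = {0}"
      using p by auto
    let ?x = "lift [:0, 1:]"
    have "?x \<notin> M"
    proof
      assume "?x \<in> M"
      then have "\<phi> ?x \<in> J"
        by (simp add: J_def)
      then show False
        by (simp add: J0 lift)
    qed
    have "ideal (M <+>\<^bsub>R\<^esub> PIdl ?x) R"
      by (intro add_ideals M.ideal_axioms cgenideal_ideal lift(1))
    moreover have "M \<subseteq> M <+>\<^bsub>R\<^esub> PIdl ?x"
    proof
      fix y assume y: "y \<in> M"
      have "\<zero> \<in> PIdl ?x"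
        by (rule additive_subgroup.zero_closed[OF ideal.axioms(1)[OF cgenideal_ideal[OF lift(1)]]])
      with y have "y \<oplus> \<zero> \<in> M <+>\<^bsub>R\<^esub> PIdl ?x"
        unfolding set_add_def' by blast
      then show "y \<in> M <+>\<^bsub>R\<^esub> PIdl ?x"
        by (simp add: M.Icarr y)
    qed
    moreover have "?x \<in> M <+>\<^bsub>R\<^esub> PIdl ?x"
    proof -
      have "\<zero> \<oplus> ?x \<in> M <+>\<^bsub>R\<^esub> PIdl ?x"
        using cgenideal_self[OF lift(1)] M.zero_closed unfolding set_add_def' by blast
      then show ?thesis
        by (simp add: lift)
    qed
    ultimately have "M <+>\<^bsub>R\<^esub> PIdl ?x = carrier R"
      using M.I_maximal[of "M <+>\<^bsub>R\<^esub> PIdl ?x"] \<open>?x \<notin> M\<close> by (metis ideal.Icarr subsetI)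
    then have "\<one> \<in> M <+>\<^bsub>R\<^esub> PIdl ?x"
      by simp
    then obtain y r where yr: "y \<in> M" "r \<in> carrier R" "\<one> = y \<oplus> r \<otimes> ?x"
      unfolding set_add_def' cgenideal_def by blast
    then have "1 = \<phi> y + \<phi> r * [:0, 1:]"
      using one M.Icarr by (metis add mult m_closed lift(1,2))
    moreover have "\<phi> y = 0"
      using J0 yr(1) by (auto simp: J_def)
    ultimately have "is_unit [:0, 1::'k:]"
      by (metis add_0 dvd_triv_right)
    then show False
      by (simp add: is_unit_iff_degree)
  qed
  have primary: "\<exists>c\<in>carrier R - M. \<exists>n::nat. c \<otimes> y [^] n \<in> Idl {x}"
    if x: "nonzerodivisor R x" and y: "y \<in> M" for x y
  proof -
    have xc: "x \<in> carrier R" and yc: "y \<in> carrier R"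
      using x y M.Icarr by (auto dest: nonzerodivisor_closed)
    have "\<one> \<noteq> \<zero>"
      using M.I_notcarr M.one_imp_carrier M.zero_closed by metis
    then have "\<phi> x \<noteq> 0"
      using nonzerodivisor_not_nilpotent[OF _ x] nilpotent[OF xc] by blast
    then obtain e n where e: "e \<notin> J" "\<phi> x dvd e * p ^ n"
      using poly_ideal_quotient_power[OF p_unit p_nonzero p(2)] by blast
    have "p ^ n dvd \<phi> y ^ n"
      using p(2) y by (intro dvd_power_same) (auto simp: J_def)
    then have "\<phi> x dvd e * \<phi> y ^ n"
      using e(2) by (meson dvd_refl dvd_trans mult_dvd_mono)
    then obtain h where h: "e * \<phi> y ^ n = \<phi> x * h"
      by blast
    define c w where "c = lift e" and "w = lift h"
    have c: "c \<in> carrier R" "c \<notin> M" and w: "w \<in> carrier R"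
      using lift(1,2) e(1) by (simp_all add: c_def w_def J_def) (metis imageI)
    define v where "v = c \<otimes> y [^] n"
    have v: "v \<in> carrier R"
      using c yc by (simp add: v_def)
    have "\<phi> (v \<ominus> x \<otimes> w) = 0"
      using h c yc xc w v by (simp add: v_def a_minus_def add minus mult pow c_def w_def lift)
    then have "v \<ominus> x \<otimes> w \<in> nilradical R"
      using v xc w by (intro nilpotent) simp_all
    then obtain N :: nat where N: "(v \<ominus> x \<otimes> w) [^] N = \<zero>"
      by (auto simp: nilradical_def)
    \<comment> \<open>The equation v = x w holds in R only up to a nilpotent. Since v and v - x w
      have congruent powers modulo (x), the N-th power of v lies in (x), where N annihilates the
      error.\<close>
    have "v [^] k \<ominus> (v \<ominus> x \<otimes> w) [^] k \<in> Idl {x}" for k :: nat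
    proof (induction k)
      case 0
      then show ?case
        using xc additive_subgroup.zero_closed[OF ideal.axioms(1)[OF genideal_ideal[of "{x}"]]]
        by (simp add: a_minus_def r_neg)
    next
      case (Suc k)
      interpret I: ideal "Idl {x}" R
        using xc by (intro genideal_ideal) simp
      have "v [^] Suc k \<ominus> (v \<ominus> x \<otimes> w) [^] Suc k
          = (v [^] k \<ominus> (v \<ominus> x \<otimes> w) [^] k) \<otimes> v \<oplus> x \<otimes> ((v \<ominus> x \<otimes> w) [^] k \<otimes> w)"
        (is "?l = ?r")
      proof -
        define u where "u = (v \<ominus> x \<otimes> w) [^] k"
        have "u \<in> carrier R"
          using v xc w by (simp add: u_def)
        then have "v [^] k \<otimes> v \<ominus> u \<otimes> (v \<ominus> x \<otimes> w) = (v [^] k \<ominus> u) \<otimes> v \<oplus> x \<otimes> (u \<otimes> w)"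
          using v xc w nat_pow_closed[OF v, of k] by algebra
        then show ?thesis by (simp add: u_def)
      qed
      moreover have "?r \<in> Idl {x}"
        using Suc v xc w genideal_self'[OF xc] by (intro I.a_closed I.I_r_closed) simp_all
      ultimately show ?case by simp
    qed
    from this[of N] have "v [^] N \<in> Idl {x}"
      unfolding N using v by (simp add: a_minus_def)
    then have "c [^] N \<otimes> y [^] (n * N) \<in> Idl {x}"
      using c yc by (simp add: v_def nat_pow_distrib nat_pow_pow)
    moreover have "c [^] N \<in> carrier R - M"
      using c(2) M.pow_mem_imp_mem[OF c(1), of N] nat_pow_closed[OF c(1), of N] by blast
    ultimately show ?thesis by blast
  qed
  have "nonzerodivisor R (lift p)"
    using p_nonzero lift by (intro regular) auto
  then have regular_M: "\<exists>x\<in>M. nonzerodivisor R x"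
    using lift(3) p(1) by blast
  have "x \<in> nilradical R \<or> nonzerodivisor R x" if "x \<in> carrier R" for x
    using nilpotent regular that by blast
  then have local: "one_dim_local (localization R (carrier R - M))
      {frac_class R (carrier R - M) r s | r s. r \<in> M \<and> s \<in> carrier R - M}"
    using regular_M primary by (intro localization_one_dim_local prime)
  have "localization_at R (carrier R - M)"
    by (intro localization_at.intro is_cring localization_at_axioms.intro submonoid.intro)
      (use M.I_prime M.I_notcarr M.one_imp_carrier in auto)
  then show "cohen_macaulay_local_ring (localization R (carrier R - M))"
    using one_dim_local.cohen_macaulay_local[OF local] localization_at.noetherian_Loc noetherian by blast
qed (fact is_cring noetherian)+

section \<open>Finite algebras over \<open>k[X]\<close>\<close>

text \<open>The span over k[X], which acts through h. Recursion on the list of generators allows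
  finite generation of submodules to be proved one generator at a time.\<close>

primrec linear_span :: "('a, 'm) ring_scheme \<Rightarrow> ('b \<Rightarrow> 'a) \<Rightarrow> 'a list \<Rightarrow> 'a set"
  where "linear_span R h [] = {\<zero>\<^bsub>R\<^esub>}"
  | "linear_span R h (e # es) = {h p \<otimes>\<^bsub>R\<^esub> e \<oplus>\<^bsub>R\<^esub> v | p v. v \<in> linear_span R h es}"

locale poly_algebra = cring R for R (structure) +
  fixes h :: "'k::field poly \<Rightarrow> 'a"
  assumes h_closed [simp, intro]: "h p \<in> carrier R"
    and h_add: "h (p + q) = h p \<oplus> h q"
    and h_mult: "h (p * q) = h p \<otimes> h q"
    and h_one: "h 1 = \<one>"
begin

lemma h_zero: "h 0 = \<zero>"
  using h_add[of 0 0] by (metis add_0 add.l_cancel_one' h_closed)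

lemma h_uminus: "h (- p) = \<ominus> h p"
  using h_add[of "- p" p] by (simp add: h_zero add.inv_equality)

lemma linear_span_closed:
  "set es \<subseteq> carrier R \<Longrightarrow> linear_span R h es \<subseteq> carrier R"
  by (induction es) auto

lemma linear_span_zero: "set es \<subseteq> carrier R \<Longrightarrow> \<zero> \<in> linear_span R h es"
  by (induction es) (force simp: h_zero intro: exI[of _ 0])+

lemma linear_span_add:
  assumes "set es \<subseteq> carrier R" "x \<in> linear_span R h es" "y \<in> linear_span R h es"
  shows "x \<oplus> y \<in> linear_span R h es"
  using assms
proof (induction es arbitrary: x y)
  case (Cons e es)
  then obtain p v q w where pq: "x = h p \<otimes> e \<oplus> v" "v \<in> linear_span R h es"
      "y = h q \<otimes> e \<oplus> w" "w \<in> linear_span R h es"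
    by auto
  have [simp]: "e \<in> carrier R" "v \<in> carrier R" "w \<in> carrier R"
    using Cons.prems linear_span_closed[of es] pq by auto
  have "x \<oplus> y = h (p + q) \<otimes> e \<oplus> (v \<oplus> w)"
    by (simp add: pq h_add l_distr a_ac)
  moreover have "v \<oplus> w \<in> linear_span R h es"
    using Cons pq by simp
  ultimately show ?case by auto
qed simp

lemma linear_span_mult:
  assumes "set es \<subseteq> carrier R" "x \<in> linear_span R h es"
  shows "h p \<otimes> x \<in> linear_span R h es"
  using assms
proof (induction es arbitrary: x)
  case (Cons e es)
  then obtain q v where q: "x = h q \<otimes> e \<oplus> v" "v \<in> linear_span R h es"
    by auto
  have [simp]: "e \<in> carrier R" "v \<in> carrier R"
    using Cons.prems linear_span_closed[of es] q by auto
  have "h p \<otimes> x = h (p * q) \<otimes> e \<oplus> h p \<otimes> v"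
    by (simp add: q h_mult r_distr m_assoc)
  moreover have "h p \<otimes> v \<in> linear_span R h es"
    using Cons q by simp
  ultimately show ?case by auto
qed simp

lemma linear_span_mem:
  assumes "set es \<subseteq> carrier R" "e \<in> set es"
  shows "e \<in> linear_span R h es"
  using assms
proof (induction es)
  case (Cons d es)
  show ?case
  proof (cases "e = d")
    case True
    then have "e = h 1 \<otimes> d \<oplus> \<zero>"
      using Cons.prems by (simp add: h_one)
    moreover have "\<zero> \<in> linear_span R h es"
      using Cons.prems by (intro linear_span_zero) simp
    ultimately show ?thesis
      unfolding linear_span.simps by blast
  next
    case False
    then have "e = h 0 \<otimes> d \<oplus> e" "e \<in> linear_span R h es"
      using Cons by (auto simp: h_zero)
    then show ?thesis by auto
  qed
qed simp

text \<open>The coefficients at the first generator form an ideal of \<open>k[X]\<close>, which is principal; subtracting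
  a multiple of an element realizing its generator leaves an element spanned by the other generators.\<close>

lemma submodule_finitely_generated:
  assumes "set es \<subseteq> carrier R" "J \<subseteq> linear_span R h es" "\<zero> \<in> J"
    and "\<And>x y. x \<in> J \<Longrightarrow> y \<in> J \<Longrightarrow> x \<oplus> y \<in> J"
    and "\<And>p x. x \<in> J \<Longrightarrow> h p \<otimes> x \<in> J"
  shows "\<exists>B. finite B \<and> B \<subseteq> J \<and> J \<subseteq> Idl B"
  using assms
proof (induction es arbitrary: J)
  case Nil
  then show ?case
    using genideal_self'[of \<zero>] by (intro exI[of _ "{\<zero>}"]) auto
next
  case (Cons e es)
  have es: "set es \<subseteq> carrier R" and e [simp]: "e \<in> carrier R"
    using Cons.prems(1) by auto
  have J_carrier: "J \<subseteq> carrier R"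
    using Cons.prems(1,2) linear_span_closed by blast
  note span_closed = subsetD[OF linear_span_closed[OF es]]
  define L where "L = {p. \<exists>v\<in>linear_span R h es. h p \<otimes> e \<oplus> v \<in> J}"
  have "0 \<in> L"
    using linear_span_zero[OF es] Cons.prems(3) by (auto simp: L_def h_zero intro!: bexI[of _ \<zero>])
  moreover have "p + q \<in> L" if pq: "p \<in> L" "q \<in> L" for p q
  proof -
    obtain v w where vw: "v \<in> linear_span R h es" "h p \<otimes> e \<oplus> v \<in> J"
        "w \<in> linear_span R h es" "h q \<otimes> e \<oplus> w \<in> J"
      using pq by (auto simp: L_def)
    have eq: "h (p + q) \<otimes> e \<oplus> (v \<oplus> w) = (h p \<otimes> e \<oplus> v) \<oplus> (h q \<otimes> e \<oplus> w)"
      using vw span_closed by (simp add: h_add l_distr a_ac)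
    have "h (p + q) \<otimes> e \<oplus> (v \<oplus> w) \<in> J"
      unfolding eq by (rule Cons.prems(4)[OF vw(2,4)])
    then show ?thesis
      using linear_span_add[OF es vw(1,3)] unfolding L_def by blast
  qed
  moreover have "q * p \<in> L" if p: "p \<in> L" for p q
  proof -
    obtain v where v: "v \<in> linear_span R h es" "h p \<otimes> e \<oplus> v \<in> J"
      using p by (auto simp: L_def)
    have eq: "h (q * p) \<otimes> e \<oplus> h q \<otimes> v = h q \<otimes> (h p \<otimes> e \<oplus> v)"
      using v span_closed by (simp add: h_mult r_distr m_assoc)
    have "h (q * p) \<otimes> e \<oplus> h q \<otimes> v \<in> J"
      unfolding eq by (rule Cons.prems(5)[OF v(2)])
    then show ?thesis
      using linear_span_mult[OF es v(1)] unfolding L_def by blast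
  qed
  ultimately obtain p0 where p0: "p0 \<in> L" "\<And>p. p \<in> L \<Longrightarrow> p0 dvd p"
    using poly_submodule_principal by metis
  then obtain v0 where v0: "v0 \<in> linear_span R h es" "h p0 \<otimes> e \<oplus> v0 \<in> J"
    by (auto simp: L_def)
  define j0 where "j0 = h p0 \<otimes> e \<oplus> v0"
  have "\<exists>B. finite B \<and> B \<subseteq> J \<inter> linear_span R h es \<and> J \<inter> linear_span R h es \<subseteq> Idl B"
    using Cons.prems linear_span_zero[OF es] linear_span_add[OF es] linear_span_mult[OF es]
    by (intro Cons.IH es) auto
  then obtain B where B: "finite B" "B \<subseteq> J" "J \<inter> linear_span R h es \<subseteq> Idl B"
    by blast
  have ins: "insert j0 B \<subseteq> carrier R"
    using B(2) v0(2) J_carrier by (auto simp: j0_def)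
  interpret I: ideal "Idl (insert j0 B)" R
    by (rule genideal_ideal[OF ins])
  have "x \<in> Idl (insert j0 B)" if x: "x \<in> J" for x
  proof -
    obtain p v where pv: "x = h p \<otimes> e \<oplus> v" "v \<in> linear_span R h es"
      using x Cons.prems(2) by auto
    then obtain c where c: "p = p0 * c"
      using p0(2)[of p] x by (auto simp: L_def elim!: dvdE)
    have v [simp]: "v \<in> carrier R" "v0 \<in> carrier R"
      using pv v0 span_closed by auto
    define y where "y = x \<oplus> h (- c) \<otimes> j0"
    have "y = v \<oplus> h (- c) \<otimes> v0"
      unfolding y_def j0_def pv(1) c h_mult h_uminus
      using v e h_closed[of p0] h_closed[of c] by algebra
    then have "y \<in> linear_span R h es"
      using linear_span_add[OF es pv(2) linear_span_mult[OF es v0(1)]] by simp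
    moreover have "y \<in> J"
      using Cons.prems(4)[OF x Cons.prems(5)[OF v0(2)]] by (simp add: y_def j0_def)
    ultimately have "y \<in> Idl B"
      using B(3) by blast
    also have "Idl B \<subseteq> Idl (insert j0 B)"
      by (rule genideal_minimal[OF I.ideal_axioms]) (use genideal_self[OF ins] in blast)
    finally have y: "y \<in> Idl (insert j0 B)" .
    have j0: "j0 \<in> Idl (insert j0 B)" "j0 \<in> carrier R"
      using genideal_self[OF ins] ins by auto
    have "x \<in> carrier R"
      using x J_carrier by blast
    then have "x = y \<oplus> h c \<otimes> j0"
      unfolding y_def h_uminus using j0(2) h_closed[of c] by algebra
    then show ?thesis
      using I.a_closed[OF y I.I_l_closed[OF j0(1) h_closed]] by simp
  qed
  then show ?case
    using B v0(2) by (intro exI[of _ "insert j0 B"]) (auto simp: j0_def)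
qed

text \<open>An ideal of R is in particular a k[X]-submodule, so the finite set found for submodules
  also generates it as an ideal.\<close>

lemma noetherian_of_linear_span:
  assumes es: "set es \<subseteq> carrier R" and span: "carrier R \<subseteq> linear_span R h es"
  shows "noetherian_ring R"
proof (rule noetherian_ringI)
  fix J assume J: "ideal J R"
  interpret J: ideal J R by (rule J)
  have "\<exists>B. finite B \<and> B \<subseteq> J \<and> J \<subseteq> Idl B"
    using span J.Icarr J.I_l_closed by (intro submodule_finitely_generated[OF es]) auto
  then obtain B where B: "finite B" "B \<subseteq> J" "J \<subseteq> Idl B"
    by blast
  moreover have "Idl B \<subseteq> J"
    by (rule genideal_minimal[OF J B(2)])
  moreover have "B \<subseteq> carrier R"
    using B(2) J.Icarr by blast
  ultimately show "\<exists>A\<subseteq>carrier R. finite A \<and> J = Idl A"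
    by blast
qed

end

section \<open>Exponents of the ideal \<open>Q : \<mm>^q\<close>\<close>

text \<open>For fixed j = \<alpha> + \<beta> the sums are a j + \<beta> with 0 \<le> \<beta> \<le>
  j. An offset \<beta> of a or more only passes to a later block of length a, where the quotient is
  larger and the remainder smaller.\<close>

lemma mem_semigroup_gen2_iff:
  fixes a n :: nat
  assumes "a > 0"
  shows "n \<in> semigroup_gen2 a (a + 1) \<longleftrightarrow> n mod a \<le> n div a"
proof
  assume "n \<in> semigroup_gen2 a (a + 1)"
  then obtain \<alpha> \<beta> where "n = \<alpha> * a + \<beta> * (a + 1)"
    by (auto simp: semigroup_gen2_def)
  then have n: "n = a * (\<alpha> + \<beta>) + \<beta>"
    by (simp add: algebra_simps)
  have "n mod a = \<beta> mod a" "n div a = \<alpha> + \<beta> + \<beta> div a"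
    using assms by (simp_all add: n)
  moreover have "\<beta> mod a \<le> \<alpha> + \<beta> + \<beta> div a"
    by (rule order_trans[OF mod_less_eq_dividend]) simp
  ultimately show "n mod a \<le> n div a"
    by (simp only:)
next
  assume "n mod a \<le> n div a"
  then have "(n div a - n mod a) * a + n mod a * (a + 1) = (n div a - n mod a + n mod a) * a + n mod a"
    by (simp only: algebra_simps mult_1_right)
  also have "\<dots> = n"
    using \<open>n mod a \<le> n div a\<close> by (simp only: le_add_diff_inverse2 div_mult_mod_eq)
  finally have "(n div a - n mod a) * a + n mod a * (a + 1) = n" .
  then show "n \<in> semigroup_gen2 a (a + 1)"
    unfolding semigroup_gen2_def by (metis (mono_tags, lifting) mem_Collect_eq)
qed

lemma semigroup_gen2_zero [simp]: "0 \<in> semigroup_gen2 a b"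
  by (auto simp: semigroup_gen2_def)

lemma semigroup_gen2_add:
  assumes "m \<in> semigroup_gen2 a b" "n \<in> semigroup_gen2 a b"
  shows "m + n \<in> semigroup_gen2 a b"
proof -
  obtain \<alpha> \<beta> \<gamma> \<delta> where "m = \<alpha> * a + \<beta> * b" "n = \<gamma> * a + \<delta> * b"
    using assms by (auto simp: semigroup_gen2_def)
  then have "m + n = (\<alpha> + \<gamma>) * a + (\<beta> + \<delta>) * b"
    by (simp add: algebra_simps)
  then show ?thesis
    by (auto simp: semigroup_gen2_def)
qed

text \<open>A quotient of at least a - 1 admits every remainder modulo a.\<close>

lemma semigroup_gen2_conductor:
  fixes a n :: nat
  assumes "a > 0" "n \<ge> a * (a - 1)"
  shows "n \<in> semigroup_gen2 a (a + 1)"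
proof -
  have "a - 1 \<le> n div a"
    using assms by (simp add: less_eq_div_iff_mult_less_eq mult.commute)
  moreover have "n mod a \<le> a - 1"
    using mod_less_divisor[OF assms(1), of n] by linarith
  ultimately show ?thesis
    using assms(1) by (subst mem_semigroup_gen2_iff) (auto intro: order_trans)
qed

text \<open>\<open>a (a - 1) - 1\<close> is the Frobenius number of \<open>\<langle>a, a + 1\<rangle>\<close>.\<close>

lemma semigroup_gen2_below_conductor:
  fixes a n :: nat
  assumes "a \<ge> 2" "n \<ge> a * (a - 2)" "n \<noteq> a * (a - 1) - 1"
  shows "n \<in> semigroup_gen2 a (a + 1)"
proof (cases "n \<ge> a * (a - 1)")
  case False
  have eq: "a * (a - 1) = a * (a - 2) + a"
    using assms by (cases a rule: nat.exhaust; cases "a - 1") (auto simp: algebra_simps)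
  \<comment> \<open>In the block from a (a - 2) to a (a - 1) the quotient is a - 2, so a - 1 is the
    only remainder that is missing.\<close>
  define r where "r = n - a * (a - 2)"
  have n: "n = a * (a - 2) + r" and r: "r < a - 1"
    using assms False eq by (auto simp: r_def)
  then have "n div a = a - 2" "n mod a = r"
    by simp_all
  then show ?thesis
    using r assms(1) by (subst mem_semigroup_gen2_iff) simp_all
qed (use assms semigroup_gen2_conductor in auto)

definition sumset :: "nat set \<Rightarrow> nat set \<Rightarrow> nat set"
  where "sumset E F = {x + y | x y. x \<in> E \<and> y \<in> F}"

lemma sumsetI: "x \<in> E \<Longrightarrow> y \<in> F \<Longrightarrow> x + y \<in> sumset E F"
  by (auto simp: sumset_def)

locale colon_exponents =
  fixes a q s :: nat
  assumes a: "a \<ge> 2" and s_pos: "0 < s" and s_mem: "s \<in> semigroup_gen2 a (a + 1)"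
    and q_pos: "0 < q" and q_less: "q < a"
begin

definition H where "H = semigroup_gen2 a (a + 1)"

lemma mem_H_iff: "n \<in> H \<longleftrightarrow> n mod a \<le> n div a"
  unfolding H_def using a by (intro mem_semigroup_gen2_iff) simp

lemma zero_mem_H [simp]: "0 \<in> H"
  by (simp add: H_def)

lemma s_mem_H: "s \<in> H"
  using s_mem by (simp add: H_def)

lemma H_add: "x \<in> H \<Longrightarrow> y \<in> H \<Longrightarrow> x + y \<in> H"
  unfolding H_def by (rule semigroup_gen2_add)

lemma H_conductor: "a * (a - 1) \<le> n \<Longrightarrow> n \<in> H"
  unfolding H_def using a by (intro semigroup_gen2_conductor) simp_all

lemma H_below_conductor: "a * (a - 2) \<le> n \<Longrightarrow> n \<noteq> a * (a - 1) - 1 \<Longrightarrow> n \<in> H"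
  unfolding H_def using a by (intro semigroup_gen2_below_conductor)

lemma gen_mem_H: "\<alpha> * a + \<beta> * (a + 1) \<in> H"
  unfolding H_def semigroup_gen2_def by blast

definition N :: nat where "N = s + a * (a - 1 - q)"

definition E :: "nat set" where "E = {h \<in> H. h \<in> (+) s ` H \<or> N \<le> h}"

text \<open>Put \<open>z = h + a q - s\<close>; the condition forces \<open>z, z + 1, \<dots>, z + q\<close> into \<open>H\<close>. If this run stays within
  one period of length \<open>a\<close>, its last element shows \<open>z - a q \<in> H\<close>, that is \<open>h \<in> s + H\<close>. Otherwise the run
  contains a number congruent to \<open>a - 1\<close> modulo \<open>a\<close>, which puts \<open>z\<close> above the conductor \<open>a (a - 1)\<close>, and
  \<open>N\<close> is the corresponding bound for \<open>h\<close>.\<close>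

lemma mem_E_iff:
  assumes h: "h \<in> H"
  shows "h \<in> E \<longleftrightarrow> (\<forall>\<alpha> \<beta>. q \<le> \<alpha> + \<beta> \<longrightarrow> h + (\<alpha> * a + \<beta> * (a + 1)) \<in> (+) s ` H)"
proof
  have conductor: "a * q + a * (a - 1 - q) = a * (a - 1)"
    using q_less by (simp flip: add_mult_distrib2)
  {
    assume E: "h \<in> E"
    show "\<forall>\<alpha> \<beta>. q \<le> \<alpha> + \<beta> \<longrightarrow> h + (\<alpha> * a + \<beta> * (a + 1)) \<in> (+) s ` H"
    proof (intro allI impI)
      fix \<alpha> \<beta> :: nat assume "q \<le> \<alpha> + \<beta>"
      let ?g = "\<alpha> * a + \<beta> * (a + 1)"
      have g: "?g \<in> H"
        by (rule gen_mem_H)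
      have "a * q \<le> a * (\<alpha> + \<beta>)"
        using \<open>q \<le> \<alpha> + \<beta>\<close> by simp
      then have "a * q \<le> ?g"
        by (simp add: algebra_simps)
      show "h + ?g \<in> (+) s ` H"
      proof (cases "h \<in> (+) s ` H")
        case True
        then obtain x where "x \<in> H" "h = s + x" by blast
        then show ?thesis
          using H_add[OF _ g, of x] by (auto simp: add.assoc)
      next
        case False
        then have "N \<le> h"
          using E by (simp add: E_def)
        then have "a * (a - 1) \<le> h + ?g - s" "h + ?g = s + (h + ?g - s)"
          using \<open>a * q \<le> ?g\<close> conductor by (auto simp: N_def)
        then show ?thesis
          using H_conductor by blast
      qed
    qed
  }
  {
    assume *: "\<forall>\<alpha> \<beta>. q \<le> \<alpha> + \<beta> \<longrightarrow> h + (\<alpha> * a + \<beta> * (a + 1)) \<in> (+) s ` H"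
    have run: "h + (a * q + i) \<in> (+) s ` H" if "i \<le> q" for i
    proof -
      have "(q - i) * a + i * (a + 1) = (q - i + i) * a + i"
        by (simp only: algebra_simps)
      then have "(q - i) * a + i * (a + 1) = a * q + i"
        using that by simp
      then show ?thesis
        using *[rule_format, of "q - i" i] that by (simp only: le_add_diff_inverse2 order_refl)
    qed
    define z where "z = h + a * q - s"
    have "s \<le> h + a * q"
      using run[of 0] by auto
    then have z: "h + a * q = s + z"
      by (simp add: z_def)
    have zH: "z + i \<in> H" if i: "i \<le> q" for i
    proof -
      obtain x where "x \<in> H" "h + (a * q + i) = s + x"
        using run[OF i] by blast
      moreover from this z have "x = z + i"
        by simp
      ultimately show ?thesis by simp
    qed
    have mem: "(z + i) mod a \<le> (z + i) div a" if "i \<le> q" for i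
      using zH[OF that] by (simp add: mem_H_iff)
    define j r where "j = z div a" and "r = z mod a"
    have zjr: "z = a * j + r" and r: "r < a"
      using a by (auto simp: j_def r_def)
    show "h \<in> E"
    proof (cases "r + q < a")
      case True
      have "(z + q) mod a = r + q" "(z + q) div a = j"
        using True by (simp_all add: zjr add.assoc)
      with mem[of q] have "r + q \<le> j"
        by simp
      then have "a * q \<le> a * j" "a * (j - q) = a * j - a * q"
        by (simp_all add: diff_mult_distrib2)
      then have "h = s + (a * (j - q) + r)"
        using z zjr by linarith
      moreover have "a * (j - q) + r \<in> H"
        using \<open>r + q \<le> j\<close> r by (subst mem_H_iff) auto
      ultimately show ?thesis
        using h by (auto simp: E_def)
    next
      case False
      define i where "i = a - 1 - r"
      have i: "i \<le> q" "z + i = a * j + (a - 1)"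
        using False r by (auto simp: i_def zjr)
      have "(z + i) mod a = (a - 1) mod a" "(z + i) div a = j + (a - 1) div a"
        unfolding i(2) using a by (simp_all only: mod_mult_self4 div_mult_self4)
      then have "a - 1 \<le> j"
        using mem[OF i(1)] a by simp
      then have "a * (a - 1) \<le> z"
        by (simp add: zjr trans_le_add1)
      then have "N \<le> h"
        using z conductor by (simp add: N_def)
      then show ?thesis
        using h by (simp add: E_def)
    qed
  }
qed

text \<open>The exponents of I^n. The zeroth power of I is the whole ring, so the recursion starts
  with \<open>H\<close> and not with {0}.\<close>

fun pow_E :: "nat \<Rightarrow> nat set"
  where "pow_E 0 = H"
  | "pow_E (Suc n) = sumset (pow_E n) E"

lemma N_ge: "s \<le> N"
  by (simp add: N_def)

lemma E_subset_H: "E \<subseteq> H"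
  by (auto simp: E_def)

lemma E_add: "x \<in> E \<Longrightarrow> h \<in> H \<Longrightarrow> x + h \<in> E"
  using H_add[of _ h]
  by (fastforce simp: E_def add.assoc)

lemma s_add_mem_E: "h \<in> H \<Longrightarrow> s + h \<in> E"
  using H_add[OF s_mem_H] by (auto simp: E_def)

lemma s_mem_E: "s \<in> E"
  using s_add_mem_E[of 0] by simp

lemma E_ge: "x \<in> E \<Longrightarrow> s \<le> x"
  using N_ge by (auto simp: E_def)

lemma pow_E_add: "x \<in> pow_E n \<Longrightarrow> h \<in> H \<Longrightarrow> x + h \<in> pow_E n"
proof (induction n arbitrary: x)
  case 0
  then show ?case by (simp add: H_add)
next
  case (Suc n)
  then obtain y z where "y \<in> pow_E n" "z \<in> E" "x = y + z"
    by (auto simp: sumset_def)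
  then show ?case
    using E_add[of z h] Suc.prems by (auto simp: add.assoc intro: sumsetI)
qed

lemma pow_E_1: "pow_E (Suc 0) = E"
proof
  show "pow_E (Suc 0) \<subseteq> E"
    by (auto simp: sumset_def) (metis E_add add.commute)
  show "E \<subseteq> pow_E (Suc 0)"
    using sumsetI[OF zero_mem_H, of _ E] by auto
qed

lemma pow_E_2: "pow_E 2 = sumset E E"
  using pow_E_1 by (simp add: numeral_2_eq_2)

lemma pow_E_3_eq: "pow_E 3 = sumset (sumset E E) E"
  using pow_E_1 by (simp add: numeral_3_eq_3)

lemma pow_E_sum:
  assumes "x \<in> pow_E m" "y \<in> pow_E n"
  shows "x + y \<in> pow_E (m + n)"
  using assms(2)
proof (induction n arbitrary: y)
  case 0
  then show ?case using pow_E_add[OF assms(1)] by simp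
next
  case (Suc n)
  then obtain u v where "u \<in> pow_E n" "v \<in> E" "y = u + v"
    by (auto simp: sumset_def)
  then show ?case
    using Suc.IH by (auto simp flip: add.assoc intro: sumsetI)
qed

lemma pow_E_Suc_subset: "pow_E (Suc n) \<subseteq> pow_E n"
  using pow_E_add E_subset_H by (auto simp: sumset_def)

lemma s_add_pow_E: "x \<in> pow_E n \<Longrightarrow> s + x \<in> pow_E (Suc n)"
  using s_mem_E by (auto simp: add.commute[of s] intro: sumsetI)

lemma pow_E_ge: "x \<in> pow_E n \<Longrightarrow> n * s \<le> x"
proof (induction n arbitrary: x)
  case (Suc n)
  then show ?case using E_ge by (fastforce simp: sumset_def)
qed simp

lemma mult_s_mem_pow_E: "n * s \<in> pow_E n"
  by (induction n) (use s_add_pow_E in auto)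

text \<open>Subtracting s n times leaves a number above the conductor of \<open>H\<close>; adding
  each s back raises the power of I by one. The bound thus moves with n s only, which later makes
  one nilpotency exponent work in all degrees.\<close>

lemma mem_pow_E_large: "N + a * (a - 1) + n * s \<le> x \<Longrightarrow> x \<in> pow_E n"
proof (induction n arbitrary: x)
  case 0
  then show ?case using H_conductor[of x] by simp
next
  case (Suc n)
  then show ?case using s_add_pow_E[of "x - s" n] by simp
qed

text \<open>If a summand lies in s + H, removing s from it leaves an element of \<open>E\<close>
  plus one of \<open>H\<close>. Otherwise both summands are at least N, and N \<ge> s keeps the
  difference at least N.\<close>

lemma E_sum_reduce:
  assumes "x \<in> E" "y \<in> E" "x + y - s \<in> H"
  shows "x + y - s \<in> E"
proof (cases "x \<in> (+) s ` H \<or> y \<in> (+) s ` H")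
  case True
  then obtain u v where "u \<in> H" "v \<in> E" "x + y = s + (v + u)"
    using assms by auto
  then show ?thesis
    using E_add[of v u] by simp
next
  case False
  then have "N \<le> x + y - s"
    using assms N_ge by (auto simp: E_def)
  then show ?thesis
    using assms by (simp add: E_def)
qed

lemma pow_E_2_if_large:
  assumes "a * q \<le> s" "x \<in> pow_E 2"
  obtains y where "y \<in> E" "x = s + y"
proof -
  obtain u v where uv: "u \<in> E" "v \<in> E" "x = u + v"
    using assms(2) by (auto simp: pow_E_2 sumset_def)
  have "u + v - s \<in> H"
  proof (cases "u \<in> (+) s ` H \<or> v \<in> (+) s ` H")
    case True
    then obtain x y where "x \<in> H" "y \<in> H" "u + v - s = x + y"
      using uv E_subset_H by auto
    then show ?thesis by (simp add: H_add)
  next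
    case False
    then have "N \<le> u + v - s"
      using uv N_ge by (auto simp: E_def)
    moreover have "a * (a - 1) \<le> N"
    proof -
      have "a * (a - 1) = a * q + a * (a - 1 - q)"
        using q_less by (simp flip: add_mult_distrib2)
      then show ?thesis
        using assms(1) by (simp add: N_def)
    qed
    ultimately show ?thesis
      by (intro H_conductor) simp
  qed
  then have "u + v - s \<in> E"
    using E_sum_reduce uv by simp
  with that[of "u + v - s"] show thesis
    using uv E_ge[of u] by simp
qed

lemma N_ge_below_conductor:
  assumes "a * (q - 1) \<le> s"
  shows "a * (a - 2) \<le> N"
proof -
  have "a * (a - 2) = a * (q - 1) + a * (a - 1 - q)"
    using q_less q_pos by (simp flip: add_mult_distrib2)
  then show ?thesis
    using assms(1) by (simp add: N_def)
qed

text \<open>Failure forces u and v outside s + H, hence u + v - s \<ge> N. From N on the Frobenius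
  number is the only possible gap.\<close>

lemma E_sum_cases:
  assumes "a * (q - 1) \<le> s" "u \<in> E" "v \<in> E"
  shows "u + v - s \<in> E \<or> u + v - s = a * (a - 1) - 1 \<and> u \<notin> (+) s ` H \<and> v \<notin> (+) s ` H"
proof (cases "u + v - s \<in> H")
  case True
  then show ?thesis using E_sum_reduce assms by simp
next
  case False
  have not_in: "u \<notin> (+) s ` H \<and> v \<notin> (+) s ` H"
  proof (rule ccontr)
    assume "\<not> ?thesis"
    then obtain x y where "x \<in> H" "y \<in> H" "u + v - s = x + y"
      using assms(2,3) E_subset_H by auto
    then show False using False by (simp add: H_add)
  qed
  then have "N \<le> u + v - s"
    using assms N_ge by (auto simp: E_def)
  moreover have "a * (a - 2) \<le> N"
    using assms(1) by (rule N_ge_below_conductor)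
  ultimately show ?thesis
    using H_below_conductor[of "u + v - s"] False not_in by fastforce
qed

text \<open>If none of \<open>u + v - s\<close>, \<open>u + w - s\<close>, \<open>v + w - s\<close> lies in \<open>E\<close>, all three equal the Frobenius
  number \<open>F\<close>, so \<open>u = v = w = (s + F) / 2\<close> and \<open>u + v + w - s = (u - 1) + (F + 1)\<close>.\<close>

lemma pow_E_3:
  assumes s: "a * (q - 1) \<le> s" and x: "x \<in> pow_E 3"
  obtains y where "y \<in> pow_E 2" "x = s + y"
proof -
  define F where "F = a * (a - 1) - 1"
  obtain u v w where uvw: "u \<in> E" "v \<in> E" "w \<in> E" "x = u + v + w"
    using x by (auto simp: pow_E_3_eq sumset_def)
  have ge: "s \<le> u" "s \<le> v" "s \<le> w"
    using uvw E_ge by auto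
  have E2: "y + z \<in> pow_E 2" if "y \<in> E" "z \<in> E" for y z
    using that by (auto simp: pow_E_2 intro: sumsetI)
  show thesis
  proof (cases "u + v - s \<in> E \<or> u + w - s \<in> E \<or> v + w - s \<in> E")
    case True
    moreover have "x - s = u + v - s + w" "x - s = u + w - s + v" "x - s = v + w - s + u"
      using uvw(4) ge by simp_all
    ultimately have "x - s \<in> pow_E 2"
      using E2 uvw(1-3) by metis
    with that[of "x - s"] show thesis
      using uvw(4) ge by simp
  next
    case False
    then have eqs: "u + v - s = F" "u + w - s = F" "v + w - s = F" and notin: "u \<notin> (+) s ` H"
      using E_sum_cases[OF s] uvw unfolding F_def by blast+
    have "u \<noteq> s"
      using notin by force
    then have "s < u" using ge by simp
    have "u + u = s + F" "v = u" "w = u"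
      using eqs ge by auto
    moreover have "2 \<le> a * (a - 1)"
      using a by (cases a; cases "a - 1") auto
    ultimately have uF: "u + u = s + F" "v = u" "w = u" "u \<le> F" "F + 1 = a * (a - 1)"
      using ge by (auto simp: F_def)
    have N: "N \<le> u" "a * (a - 2) \<le> N"
      using uvw(1) notin N_ge_below_conductor[OF s] by (auto simp: E_def)
    \<comment> \<open>Otherwise N \<ge> s + a, and 2 u = s + F with u \<ge> N gives F \<ge> N + a
      \<ge> a (a - 2) + a = F + 1. With N = s and s < u, the number u - 1 is still at least N, so
      lowering u by one stays in \<open>E\<close>.\<close>
    have "N = s"
    proof (rule ccontr)
      assume "N \<noteq> s"
      then have "1 \<le> a - 1 - q"
        by (cases "a - 1 - q") (auto simp: N_def)
      then have "a * 1 \<le> a * (a - 1 - q)"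
        by (rule mult_le_mono2)
      then have "a * (a - 2) + a \<le> F"
        using N uF(1) N_def by linarith
      moreover have "a * (a - 2) + a = a * (a - 1)"
        using a by (auto simp: le_iff_add algebra_simps)
      ultimately show False
        using uF(5) by simp
    qed
    then have "N \<le> u - 1" "u - 1 \<noteq> F"
      using \<open>s < u\<close> uF(4) by linarith+
    moreover from this have "u - 1 \<in> H"
      using N(2) by (intro H_below_conductor) (auto simp: F_def)
    ultimately have "u - 1 \<in> E"
      by (simp add: E_def)
    moreover have "F + 1 \<in> E"
      using N(1) uF(4) uF(5) H_conductor[of "F + 1"]
      by (simp add: E_def)
    ultimately have "u - 1 + (F + 1) \<in> pow_E 2"
      by (rule E2)
    with that show thesis
      using uvw(4) uF(1) uF(2,3) \<open>s < u\<close> by simp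
  qed
qed

end

section \<open>Monomial ideals of \<open>k[[H]]\<close>\<close>

definition supported :: "nat set \<Rightarrow> 'k::field fps set"
  where "supported E = {f. \<forall>n. fps_nth f n \<noteq> 0 \<longrightarrow> n \<in> E}"

lemma supportedI: "(\<And>n. fps_nth f n \<noteq> 0 \<Longrightarrow> n \<in> E) \<Longrightarrow> f \<in> supported E"
  by (simp add: supported_def)

lemma supported_mono: "E \<subseteq> F \<Longrightarrow> supported E \<subseteq> supported F"
  by (auto simp: supported_def)

lemma supported_zero [simp]: "0 \<in> supported E"
  by (simp add: supported_def)

lemma supported_add: "f \<in> supported E \<Longrightarrow> g \<in> supported E \<Longrightarrow> f + g \<in> supported E"
  by (auto simp: supported_def) (metis add_0)

lemma supported_uminus: "f \<in> supported E \<Longrightarrow> - f \<in> supported E"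
  by (simp add: supported_def)

lemma supported_diff: "f \<in> supported E \<Longrightarrow> g \<in> supported E \<Longrightarrow> f - g \<in> supported E"
  using supported_add[OF _ supported_uminus, of f E g] by simp

lemma supported_sum: "(\<And>i. i \<in> B \<Longrightarrow> f i \<in> supported E) \<Longrightarrow> sum f B \<in> supported E"
  by (induction B rule: infinite_finite_induct) (auto intro: supported_add)

lemma supported_mult:
  assumes "f \<in> supported E" "g \<in> supported F"
  shows "f * g \<in> supported (sumset E F)"
proof (rule supportedI)
  fix n assume "fps_nth (f * g) n \<noteq> 0"
  then obtain i where "i \<le> n" "fps_nth f i * fps_nth g (n - i) \<noteq> 0"
    unfolding fps_mult_nth by (auto elim: sum.not_neutral_contains_not_neutral)
  then have "i \<in> E" "n - i \<in> F"
    using assms by (auto simp: supported_def)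
  then show "n \<in> sumset E F"
    using sumsetI[of i E "n - i" F] \<open>i \<le> n\<close> by simp
qed

lemma fps_X_power_supported_iff: "(fps_X ^ n :: 'k::field fps) \<in> supported E \<longleftrightarrow> n \<in> E"
  by (simp add: supported_def)

lemma fps_const_supported: "0 \<in> E \<Longrightarrow> fps_const c \<in> supported E"
  by (auto simp: supported_def split: if_splits)

lemma supported_image_add_iff: "f \<in> supported ((+) n ` E) \<longleftrightarrow> (\<exists>g\<in>supported E. f = fps_X ^ n * g)"
proof
  assume f: "f \<in> supported ((+) n ` E)"
  have "f = fps_X ^ n * Abs_fps (\<lambda>i. fps_nth f (n + i))"
    using f by (force simp: fps_eq_iff fps_X_power_mult_nth supported_def)
  moreover have "Abs_fps (\<lambda>i. fps_nth f (n + i)) \<in> supported E"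
    using f by (force simp: supported_def)
  ultimately show "\<exists>g\<in>supported E. f = fps_X ^ n * g"
    by blast
next
  assume "\<exists>g\<in>supported E. f = fps_X ^ n * g"
  then obtain g where "g \<in> supported E" "f = fps_X ^ n * g"
    by blast
  then show "f \<in> supported ((+) n ` E)"
    by (auto simp: supported_def fps_X_power_mult_nth split: if_splits intro!: image_eqI[of _ "(+) n" "_ - n"])
qed

text \<open>Each coefficient of f is assigned to one translate b + F that covers its exponent, and
  the coefficients assigned to b are collected in one series.\<close>

lemma supported_sumset_decompose:
  assumes "finite B" "f \<in> supported (sumset B F)"
  shows "\<exists>g. (\<forall>b\<in>B. g b \<in> supported F) \<and> f = (\<Sum>b\<in>B. fps_X ^ b * g b)"
  using assms
proof (induction B arbitrary: f)
  case empty
  then show ?case by (auto simp: supported_def sumset_def fps_eq_iff)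
next
  case (insert b B)
  define f1 f2 where "f1 = Abs_fps (\<lambda>n. if n \<in> (+) b ` F then fps_nth f n else 0)"
    and "f2 = Abs_fps (\<lambda>n. if n \<in> (+) b ` F then 0 else fps_nth f n)"
  have f: "f = f1 + f2"
    by (simp add: fps_eq_iff f1_def f2_def)
  have "f1 \<in> supported ((+) b ` F)"
    by (auto simp: supported_def f1_def)
  then obtain g1 where g1: "g1 \<in> supported F" "f1 = fps_X ^ b * g1"
    unfolding supported_image_add_iff by blast
  have "f2 \<in> supported (sumset B F)"
    using insert.prems by (fastforce simp: supported_def f2_def sumset_def)
  then obtain g where g: "\<forall>b\<in>B. g b \<in> supported F" "f2 = (\<Sum>b\<in>B. fps_X ^ b * g b)"
    using insert.IH by blast
  have "f = (\<Sum>c\<in>insert b B. fps_X ^ c * (g(b := g1)) c)"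
    using insert.hyps g1(2) g(2) by (simp add: f) (rule sum.cong; auto)
  then show ?case
    using g(1) g1(1) by (intro exI[of _ "g(b := g1)"]) auto
qed

section \<open>The dictionary between semigroup ideals of H and monomial ideals of k[[H]]\<close>

locale numerical_monoid =
  fixes H :: "nat set"
  assumes zero_mem [simp]: "0 \<in> H"
    and add_mem: "\<And>x y. x \<in> H \<Longrightarrow> y \<in> H \<Longrightarrow> x + y \<in> H"
    and nontrivial: "\<exists>h\<in>H. 0 < h"
begin

abbreviation A :: "'k::field fps ring" where "A \<equiv> semigroup_ring H"

lemma A_simps [simp]:
  "carrier A = supported H" "f \<otimes>\<^bsub>A\<^esub> g = f * g" "f \<oplus>\<^bsub>A\<^esub> g = f + g" "\<one>\<^bsub>A\<^esub> = 1" "\<zero>\<^bsub>A\<^esub> = 0"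
  by (simp_all add: semigroup_ring_def supported_def)

lemma A_mult_closed: "f \<in> supported H \<Longrightarrow> g \<in> supported H \<Longrightarrow> f * g \<in> supported H"
  using supported_mult[of f H g H] supported_mono[of "sumset H H" H] add_mem
  by (auto simp: sumset_def)

lemma A_one_closed: "1 \<in> supported H"
  using fps_const_supported[of H 1] by simp

lemma A_cring: "cring (A :: 'k::field fps ring)"
proof (rule cringI)
  show "abelian_group (A :: 'k fps ring)"
  proof (rule abelian_groupI)
    show "\<exists>g\<in>carrier A. g \<oplus>\<^bsub>A\<^esub> f = \<zero>\<^bsub>A\<^esub>" if "f \<in> carrier A" for f :: "'k fps"
      using that by (intro bexI[of _ "- f"]) (auto intro: supported_uminus)
  qed (auto intro: supported_add simp: add_ac)
  show "comm_monoid (A :: 'k fps ring)"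
    by (rule comm_monoidI) (auto intro: A_mult_closed A_one_closed simp: mult_ac)
qed (simp add: distrib_right)

sublocale A: cring "A :: 'k::field fps ring"
  by (rule A_cring)

lemma A_uminus [simp]: "f \<in> supported H \<Longrightarrow> \<ominus>\<^bsub>A\<^esub> f = - f"
  by (intro A.minus_equality) (auto intro: supported_uminus)

definition exponent_ideal :: "nat set \<Rightarrow> bool"
  where "exponent_ideal E \<longleftrightarrow> E \<subseteq> H \<and> (\<forall>x\<in>E. \<forall>h\<in>H. x + h \<in> E)"

lemma exponent_ideal_H: "exponent_ideal H"
  by (simp add: exponent_ideal_def add_mem)

lemma exponent_ideal_sumset:
  assumes "exponent_ideal E" "exponent_ideal F"
  shows "exponent_ideal (sumset E F)"
  using assms unfolding exponent_ideal_def sumset_def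
  by (auto simp: add.assoc intro: add_mem) blast+

lemma exponent_ideal_translate: "n \<in> H \<Longrightarrow> exponent_ideal ((+) n ` H)"
  by (auto simp: exponent_ideal_def add.assoc intro: add_mem)

lemma supported_mult_exponent_ideal:
  assumes "exponent_ideal E" "f \<in> supported E" "g \<in> supported H"
  shows "f * g \<in> supported E"
  using supported_mult[OF assms(2,3)] supported_mono[of "sumset E H" E] assms(1)
  by (auto simp: sumset_def exponent_ideal_def)

lemma supported_ideal:
  assumes "exponent_ideal E"
  shows "ideal (supported E) (A :: 'k::field fps ring)"
proof (rule idealI)
  have sub: "supported E \<subseteq> (supported H :: 'k fps set)"
    using assms by (intro supported_mono) (simp add: exponent_ideal_def)
  show "subgroup (supported E) (add_monoid (A :: 'k fps ring))"
  proof (rule subgroup.intro)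
    fix f :: "'k fps" assume f: "f \<in> supported E"
    then have "\<ominus>\<^bsub>A\<^esub> f \<in> supported E"
      using sub supported_uminus[OF f] by (subst A_uminus) auto
    then show "inv\<^bsub>add_monoid A\<^esub> f \<in> supported E"
      unfolding a_inv_def .
  qed (use sub in \<open>auto intro: supported_add\<close>)
  show "x \<otimes>\<^bsub>A\<^esub> f \<in> supported E" "f \<otimes>\<^bsub>A\<^esub> x \<in> supported E"
    if "f \<in> supported E" "x \<in> carrier A" for f x :: "'k fps"
    using supported_mult_exponent_ideal[OF assms] that by (auto simp: mult.commute)
qed (rule A.ring_axioms)

text \<open>Fix a positive a \<in> H. The least elements of E in the residue classes modulo a
  generate E, as in an Apery set.\<close>

lemma exponent_ideal_finitely_generated:
  assumes "exponent_ideal E"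
  obtains B where "finite B" "B \<subseteq> E" "E = sumset B H"
proof -
  obtain a where a: "a \<in> H" "0 < a"
    using nontrivial by blast
  have mult_mem: "a * k \<in> H" for k
    by (induction k) (use a add_mem in \<open>auto simp: add.commute\<close>)
  define B where "B = {x \<in> E. \<forall>y\<in>E. y mod a = x mod a \<longrightarrow> x \<le> y}"
  have "inj_on (\<lambda>x. x mod a) B"
    by (rule inj_onI) (force simp: B_def)
  moreover have "(\<lambda>x. x mod a) ` B \<subseteq> {..<a}"
    using a by auto
  ultimately have "finite B"
    using finite_subset[OF _ finite_lessThan] finite_imageD by blast
  moreover have "E \<subseteq> sumset B H"
  proof
    fix x assume "x \<in> E"
    then obtain b where b: "b \<in> E" "b mod a = x mod a" "\<forall>y. y \<in> E \<and> y mod a = x mod a \<longrightarrow> b \<le> y"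
      using ex_has_least_nat[of "\<lambda>y. y \<in> E \<and> y mod a = x mod a" x "\<lambda>y. y"] by blast
    then have "b \<in> B" "b \<le> x"
      using \<open>x \<in> E\<close> by (auto simp: B_def)
    then have "a dvd x - b"
      using b(2) by (metis mod_eq_dvd_iff_nat)
    then obtain k where "x - b = a * k" ..
    then have "x = b + a * k"
      using \<open>b \<le> x\<close> by simp
    then show "x \<in> sumset B H"
      using \<open>b \<in> B\<close> mult_mem by (auto intro: sumsetI)
  qed
  moreover have "sumset B H \<subseteq> E"
    using assms by (auto simp: B_def sumset_def exponent_ideal_def)
  ultimately show thesis
    by (intro that[of B]) (auto simp: B_def)
qed

lemma ideal_sum_closed:
  assumes "ideal J (A :: 'k::field fps ring)" "\<And>i. i \<in> B \<Longrightarrow> f i \<in> J"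
  shows "sum f B \<in> J"
proof -
  interpret J: ideal J "A :: 'k fps ring" by fact
  show ?thesis
    using assms(2) by (induction B rule: infinite_finite_induct) (use J.zero_closed J.a_closed in auto)
qed

text \<open>A product of ideals consists of finite sums, whereas a series supported on E + F may
  have infinitely many terms. Finitely many generators of E bridge this gap.\<close>

lemma ideal_prod_supported:
  assumes E: "exponent_ideal E" and F: "exponent_ideal F"
  shows "supported E \<cdot>\<^bsub>A\<^esub> supported F = (supported (sumset E F) :: 'k::field fps set)"
proof
  show "supported E \<cdot>\<^bsub>A\<^esub> supported F \<subseteq> (supported (sumset E F) :: 'k fps set)"
  proof
    fix f :: "'k fps" assume "f \<in> supported E \<cdot>\<^bsub>A\<^esub> supported F"
    then show "f \<in> supported (sumset E F)"
      by induction (auto intro: supported_mult supported_add)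
  qed
  show "(supported (sumset E F) :: 'k fps set) \<subseteq> supported E \<cdot>\<^bsub>A\<^esub> supported F"
  proof
    fix f :: "'k fps" assume f: "f \<in> supported (sumset E F)"
    obtain B where B: "finite B" "B \<subseteq> E" "E = sumset B H"
      using exponent_ideal_finitely_generated[OF E] .
    have "sumset E F \<subseteq> sumset B F"
    proof
      fix x assume "x \<in> sumset E F"
      then obtain b h y where "b \<in> B" "h \<in> H" "y \<in> F" "x = b + (y + h)"
        unfolding B(3) by (auto simp: sumset_def add.assoc add.commute)
      then show "x \<in> sumset B F"
        using F by (auto simp: exponent_ideal_def intro: sumsetI)
    qed
    then obtain g where g: "\<forall>b\<in>B. g b \<in> supported F" "f = (\<Sum>b\<in>B. fps_X ^ b * g b)"
      using supported_sumset_decompose[OF B(1)] f supported_mono by blast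
    have "(\<Sum>b\<in>B. fps_X ^ b * g b) \<in> supported E \<cdot>\<^bsub>A\<^esub> supported F"
    proof (rule ideal_sum_closed)
      show "ideal (supported E \<cdot>\<^bsub>A\<^esub> supported F) (A :: 'k fps ring)"
        by (intro A.ideal_prod_is_ideal supported_ideal E F)
      fix b assume "b \<in> B"
      then show "fps_X ^ b * g b \<in> supported E \<cdot>\<^bsub>A\<^esub> supported F"
        using ideal_prod.prod[of "fps_X ^ b" "supported E" "g b" "supported F" A] g(1) B(2)
        by (auto simp: fps_X_power_supported_iff)
    qed
    then show "f \<in> supported E \<cdot>\<^bsub>A\<^esub> supported F"
      by (simp add: g(2))
  qed
qed

lemma cgenideal_fps_X_power:
  "PIdl\<^bsub>A\<^esub> (fps_X ^ n) = (supported ((+) n ` H) :: 'k::field fps set)"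
  by (auto simp: cgenideal_def supported_image_add_iff mult.commute)

lemma genideal_fps_X_power:
  assumes "finite B" "B \<subseteq> H"
  shows "Idl\<^bsub>A\<^esub> ((\<lambda>b. fps_X ^ b) ` B) = (supported (sumset B H) :: 'k::field fps set)"
proof
  have eB: "exponent_ideal (sumset B H)"
    using assms(2) add_mem by (auto simp: exponent_ideal_def sumset_def add.assoc) blast
  have sub: "(\<lambda>b. fps_X ^ b) ` B \<subseteq> carrier (A :: 'k fps ring)"
    using assms(2) by (auto simp: fps_X_power_supported_iff)
  show "Idl\<^bsub>A\<^esub> ((\<lambda>b. fps_X ^ b) ` B) \<subseteq> (supported (sumset B H) :: 'k fps set)"
    using sumsetI[of _ B 0 H]
    by (intro A.genideal_minimal supported_ideal eB) (auto simp: fps_X_power_supported_iff)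
  show "supported (sumset B H) \<subseteq> (Idl\<^bsub>A\<^esub> ((\<lambda>b. fps_X ^ b) ` B) :: 'k fps set)"
  proof
    fix f :: "'k fps" assume "f \<in> supported (sumset B H)"
    then obtain g where g: "\<forall>b\<in>B. g b \<in> supported H" "f = (\<Sum>b\<in>B. fps_X ^ b * g b)"
      using supported_sumset_decompose[OF assms(1)] by blast
    have I: "ideal (Idl\<^bsub>A\<^esub> ((\<lambda>b. fps_X ^ b) ` B)) (A :: 'k fps ring)"
      by (rule A.genideal_ideal[OF sub])
    have "(\<Sum>b\<in>B. fps_X ^ b * g b) \<in> Idl\<^bsub>A\<^esub> ((\<lambda>b. fps_X ^ b) ` B)"
      using ideal.I_r_closed[OF I] A.genideal_self[OF sub] g(1)
      by (intro ideal_sum_closed[OF I]) auto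
    then show "f \<in> Idl\<^bsub>A\<^esub> ((\<lambda>b. fps_X ^ b) ` B)"
      by (simp add: g(2))
  qed
qed

text \<open>Multiplying f by a monomial shifts its exponents without cancellation, so testing f
  against the monomials of the second ideal tests each exponent of f separately.\<close>

lemma colon_ideal_supported:
  assumes "exponent_ideal F"
  shows "colon_ideal A (supported E) (supported F)
    = (supported {h \<in> H. \<forall>g\<in>F. h + g \<in> E} :: 'k::field fps set)"
proof
  show "colon_ideal A (supported E) (supported F) \<subseteq> (supported {h \<in> H. \<forall>g\<in>F. h + g \<in> E} :: 'k fps set)"
  proof
    fix f :: "'k fps" assume f: "f \<in> colon_ideal A (supported E) (supported F)"
    show "f \<in> supported {h \<in> H. \<forall>g\<in>F. h + g \<in> E}"
    proof (rule supportedI, safe)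
      fix h assume h: "fps_nth f h \<noteq> 0"
      then show "h \<in> H"
        using f by (auto simp: colon_ideal_def supported_def)
      fix g assume "g \<in> F"
      then have "fps_X ^ g * f \<in> supported E"
        using f by (auto simp: colon_ideal_def fps_X_power_supported_iff)
      then show "h + g \<in> E"
        using h by (auto simp: supported_def fps_X_power_mult_nth dest: spec[of _ "h + g"])
    qed
  qed
  show "(supported {h \<in> H. \<forall>g\<in>F. h + g \<in> E} :: 'k fps set) \<subseteq> colon_ideal A (supported E) (supported F)"
  proof
    fix f :: "'k fps" assume f: "f \<in> supported {h \<in> H. \<forall>g\<in>F. h + g \<in> E}"
    have "g * f \<in> supported E" if "g \<in> supported F" for g
      using supported_mult[OF f that] supported_mono[of "sumset {h \<in> H. \<forall>g\<in>F. h + g \<in> E} F" E]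
      by (auto simp: sumset_def mult.commute)
    then show "f \<in> colon_ideal A (supported E) (supported F)"
      using f supported_mono[of "{h \<in> H. \<forall>g\<in>F. h + g \<in> E}" H] by (auto simp: colon_ideal_def)
  qed
qed

text \<open>P is any sequence satisfying the recursion, because the lemma serves both for the powers
  of the maximal ideal and for those of I.\<close>

lemma ideal_pow_supported:
  assumes "exponent_ideal E" "P 0 = H" "\<And>n. P (Suc n) = sumset (P n) E"
  shows "exponent_ideal (P n)" "ideal_pow A (supported E) n = (supported (P n) :: 'k::field fps set)"
proof -
  show P: "exponent_ideal (P n)" for n
    by (induction n) (simp_all add: assms exponent_ideal_H exponent_ideal_sumset)
  show "ideal_pow A (supported E) n = (supported (P n) :: 'k fps set)"
  proof (induction n)
    case 0
    then show ?case by (simp add: assms(2) ideals_set_def nat_pow_def)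
  next
    case (Suc n)
    then show ?case
      using ideal_prod_supported[OF P[of n] assms(1)]
      by (simp add: assms(3) ideals_set_def nat_pow_def)
  qed
qed

end

section \<open>The associated graded ring\<close>

lemma fps_mult_nth_lowest:
  assumes "\<And>k. k < m \<Longrightarrow> fps_nth f k = 0" "\<And>k. k < n \<Longrightarrow> fps_nth g k = 0"
  shows "fps_nth (f * g) (m + n) = fps_nth f m * (fps_nth g n :: 'a::semiring_0)"
proof -
  have "(\<Sum>i=0..m + n. fps_nth f i * fps_nth g (m + n - i)) = (\<Sum>i\<in>{m}. fps_nth f i * fps_nth g (m + n - i))"
  proof (rule sum.mono_neutral_right)
    show "\<forall>i\<in>{0..m + n} - {m}. fps_nth f i * fps_nth g (m + n - i) = 0"
    proof
      fix i assume "i \<in> {0..m + n} - {m}"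
      then have "i < m \<or> m + n - i < n" by auto
      then show "fps_nth f i * fps_nth g (m + n - i) = 0"
        using assms by auto
    qed
  qed auto
  then show ?thesis
    by (simp add: fps_mult_nth)
qed

lemma fps_const_sum: "fps_const (sum f B) = (\<Sum>i\<in>B. fps_const (f i))"
  by (induction B rule: infinite_finite_induct) (simp_all flip: fps_const_add)

text \<open>\<open>P n\<close> is the set of exponents of \<open>I^n\<close>, \<open>C\<close> is a common bound for the conductors of all
  \<open>P n - n s\<close>, and \<open>d\<close> is a reduction number of \<open>I\<close> with respect to \<open>t^s\<close>.\<close>

locale monomial_filtration = numerical_monoid H for H +
  fixes P :: "nat \<Rightarrow> nat set" and s C d :: nat and I :: "'k::field fps set"
  assumes P_0: "P 0 = H"
    and P_ideal: "exponent_ideal (P n)"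
    and P_add: "x \<in> P m \<Longrightarrow> y \<in> P n \<Longrightarrow> x + y \<in> P (m + n)"
    and P_Suc: "P (Suc n) \<subseteq> P n"
    and s_pos: "0 < s"
    and P_ge: "x \<in> P n \<Longrightarrow> n * s \<le> x"
    and s_mem_P: "n * s \<in> P n"
    and P_large: "C + n * s \<le> x \<Longrightarrow> x \<in> P n"
    and P_cancel: "s + y \<in> P (Suc n) \<Longrightarrow> y \<in> H \<Longrightarrow> y \<in> P n"
    and P_reduce: "x \<in> P n \<Longrightarrow> d < n \<Longrightarrow> \<exists>y\<in>P (n - 1). x = s + y"
    and I_eq: "I = supported (P 1)"
    and I_pow: "ideal_pow (semigroup_ring H) I n = supported (P n)"
begin

section \<open>The homogeneous components I^n / I^(n+1)\<close>

definition J :: "nat \<Rightarrow> 'k fps set" where "J n = supported (P n)"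

definition gr :: "nat \<Rightarrow> 'k fps \<Rightarrow> 'k fps set" where "gr n f = J (Suc n) +>\<^bsub>A\<^esub> f"

abbreviation G where "G \<equiv> assoc_graded (A :: 'k fps ring) I"

lemma J_ideal: "ideal (J n) A"
  unfolding J_def by (intro supported_ideal P_ideal)

lemma J_Suc: "f \<in> J (Suc n) \<Longrightarrow> f \<in> J n"
  using supported_mono[OF P_Suc] unfolding J_def by blast

lemma J_subset: "f \<in> J n \<Longrightarrow> f \<in> supported H"
  using supported_mono[of "P n" H] P_ideal[of n] by (auto simp: J_def exponent_ideal_def)

lemma J_zero [simp]: "0 \<in> J n"
  by (simp add: J_def)

lemma J_add: "f \<in> J n \<Longrightarrow> g \<in> J n \<Longrightarrow> f + g \<in> J n"
  by (simp add: J_def supported_add)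

lemma J_diff: "f \<in> J n \<Longrightarrow> g \<in> J n \<Longrightarrow> f - g \<in> J n"
  by (simp add: J_def supported_diff)

lemma J_uminus: "f \<in> J n \<Longrightarrow> - f \<in> J n"
  by (simp add: J_def supported_uminus)

lemma J_sum: "(\<And>i. i \<in> B \<Longrightarrow> f i \<in> J n) \<Longrightarrow> sum f B \<in> J n"
  unfolding J_def by (rule supported_sum)

lemma J_mult: "f \<in> J m \<Longrightarrow> g \<in> J n \<Longrightarrow> f * g \<in> J (m + n)"
  using supported_mult[of f "P m" g "P n"] supported_mono[of "sumset (P m) (P n)" "P (m + n)"] P_add
  by (auto simp: J_def sumset_def)

lemma J_nth_below: "f \<in> J n \<Longrightarrow> k < n * s \<Longrightarrow> fps_nth f k = 0"
  using P_ge[of k n] unfolding J_def supported_def by force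

lemma J_nth_Suc: "f \<in> J (Suc n) \<Longrightarrow> fps_nth f (n * s) = 0"
  using s_pos by (intro J_nth_below) auto

lemma mem_gr_iff: "g \<in> gr n f \<longleftrightarrow> g - f \<in> J (Suc n)"
  by (force simp: gr_def a_r_coset_def')

lemma gr_eq_iff: "gr n f = gr n g \<longleftrightarrow> f - g \<in> J (Suc n)"
proof
  assume "gr n f = gr n g"
  then have "f \<in> gr n g"
    using mem_gr_iff[of f n f] by simp
  then show "f - g \<in> J (Suc n)"
    by (simp add: mem_gr_iff)
next
  assume *: "f - g \<in> J (Suc n)"
  have "x - f \<in> J (Suc n) \<longleftrightarrow> x - g \<in> J (Suc n)" for x
    using J_add[OF _ *, of "x - f"] J_diff[OF _ *, of "x - g"] by auto
  then have "x \<in> gr n f \<longleftrightarrow> x \<in> gr n g" for x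
    unfolding mem_gr_iff .
  then show "gr n f = gr n g"
    by blast
qed

lemma gr_0: "gr n 0 = J (Suc n)"
  by (auto simp: mem_gr_iff)

lemma gr_add: "f \<in> supported H \<Longrightarrow> g \<in> supported H \<Longrightarrow> gr n f <+>\<^bsub>A\<^esub> gr n g = gr n (f + g)"
proof -
  interpret ideal "J (Suc n)" A by (rule J_ideal)
  show "f \<in> supported H \<Longrightarrow> g \<in> supported H \<Longrightarrow> gr n f <+>\<^bsub>A\<^esub> gr n g = gr n (f + g)"
    using a_rcos_sum[of f g] by (simp add: gr_def)
qed

text \<open>Representatives do not matter because x y - f g = (x - f) y + f (y - g), and both terms
  lie in I^(m+n+1).\<close>

lemma gr_mult:
  assumes "f \<in> J m" "g \<in> J n"
  shows "rcoset_mult A (J (Suc (m + n))) (gr m f) (gr n g) = gr (m + n) (f * g)"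
proof -
  have "gr (m + n) (x * y) = gr (m + n) (f * g)" if x: "x \<in> gr m f" and y: "y \<in> gr n g" for x y
  proof -
    have "y - g \<in> J n"
      using y unfolding mem_gr_iff by (rule J_Suc)
    from J_add[OF this assms(2)] have "y \<in> J n"
      by simp
    then have "(x - f) * y \<in> J (Suc m + n)"
      using x by (intro J_mult) (simp_all add: mem_gr_iff)
    moreover have "f * (y - g) \<in> J (m + Suc n)"
      using y assms(1) by (intro J_mult) (simp_all add: mem_gr_iff)
    ultimately have "(x - f) * y + f * (y - g) \<in> J (Suc (m + n))"
      by (intro J_add) simp_all
    then show ?thesis
      by (simp add: gr_eq_iff algebra_simps)
  qed
  moreover have "f \<in> gr m f" "g \<in> gr n g"
    by (simp_all add: mem_gr_iff)
  ultimately have "(\<Union>x\<in>gr m f. \<Union>y\<in>gr n g. gr (m + n) (x * y)) = gr (m + n) (f * g)"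
    by blast
  then show ?thesis
    by (simp add: rcoset_mult_def gr_def)
qed

lemma finsum_A: "(\<And>i. i \<in> B \<Longrightarrow> f i \<in> supported H) \<Longrightarrow> finsum A f B = sum f B"
proof (induction B rule: infinite_finite_induct)
  case (infinite B)
  then show ?case by (simp add: A.finsum_infinite)
qed (simp_all add: Pi_def)

lemma finsum_gr:
  assumes "\<And>i. i \<in> B \<Longrightarrow> f i \<in> supported H"
  shows "finsum (A Quot J (Suc n)) (\<lambda>i. gr n (f i)) B = gr n (sum f B)"
proof -
  interpret ideal "J (Suc n)" A by (rule J_ideal)
  interpret h: ring_hom_cring A "A Quot J (Suc n)" "(+>\<^bsub>A\<^esub>) (J (Suc n))"
    by (rule rcos_ring_hom_cring[OF A_cring])
  show ?thesis
    using h.hom_finsum[of f B] assms by (simp add: finsum_A gr_def Pi_def o_def)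
qed

text \<open>The graded ring is a quotient of the Rees algebra, realized inside \<open>k[[t]][T]\<close>.\<close>

definition Rees :: "'k fps poly set" where "Rees = {F. \<forall>n. coeff F n \<in> J n}"

definition \<Theta> :: "'k fps poly \<Rightarrow> nat \<Rightarrow> 'k fps set" where "\<Theta> F n = gr n (coeff F n)"

lemma Rees_zero [simp]: "0 \<in> Rees"
  by (simp add: Rees_def)

lemma Rees_one [simp]: "1 \<in> Rees"
  using A_one_closed P_0 by (simp add: Rees_def J_def)

lemma Rees_add: "F \<in> Rees \<Longrightarrow> F' \<in> Rees \<Longrightarrow> F + F' \<in> Rees"
  by (simp add: Rees_def J_add)

lemma Rees_uminus: "F \<in> Rees \<Longrightarrow> - F \<in> Rees"
  by (simp add: Rees_def J_uminus)

lemma Rees_diff: "F \<in> Rees \<Longrightarrow> F' \<in> Rees \<Longrightarrow> F - F' \<in> Rees"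
  by (simp add: Rees_def J_diff)

lemma Rees_mult: "F \<in> Rees \<Longrightarrow> F' \<in> Rees \<Longrightarrow> F * F' \<in> Rees"
  unfolding Rees_def coeff_mult mem_Collect_eq
  by (intro allI J_sum) (metis J_mult atMost_iff le_add_diff_inverse)

lemma Rees_power: "F \<in> Rees \<Longrightarrow> F ^ n \<in> Rees"
  by (induction n) (simp_all add: Rees_mult)

lemma Rees_monom_iff: "monom f n \<in> Rees \<longleftrightarrow> f \<in> J n"
  by (auto simp: Rees_def)

lemma \<Theta>_eq_iff: "\<Theta> F = \<Theta> F' \<longleftrightarrow> (\<forall>n. coeff (F - F') n \<in> J (Suc n))"
  by (simp add: fun_eq_iff \<Theta>_def gr_eq_iff)

lemma G_eq: "G = \<lparr>carrier = {u. (\<forall>n. \<exists>x\<in>J n. u n = gr n x) \<and> finite {n. u n \<noteq> gr n 0}},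
    mult = (\<lambda>u v n. finsum (A Quot J (Suc n)) (\<lambda>i. rcoset_mult A (J (Suc n)) (u i) (v (n - i))) {..n}),
    one = (\<lambda>n. if n = 0 then gr 0 1 else gr n 0), zero = (\<lambda>n. gr n 0), add = (\<lambda>u v n. u n <+>\<^bsub>A\<^esub> v n)\<rparr>"
  unfolding assoc_graded_def I_pow gr_0 by (simp add: gr_def J_def I_eq fun_eq_iff)

lemma G_zero: "\<zero>\<^bsub>G\<^esub> = \<Theta> 0"
  by (simp add: G_eq \<Theta>_def fun_eq_iff)

lemma G_one: "\<one>\<^bsub>G\<^esub> = \<Theta> 1"
  by (simp add: G_eq \<Theta>_def fun_eq_iff)

lemma G_add:
  assumes "F \<in> Rees" "F' \<in> Rees"
  shows "\<Theta> F \<oplus>\<^bsub>G\<^esub> \<Theta> F' = \<Theta> (F + F')"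
proof -
  have "coeff F n \<in> supported H" "coeff F' n \<in> supported H" for n
    using assms J_subset unfolding Rees_def by blast+
  then show ?thesis
    by (simp add: G_eq \<Theta>_def gr_add fun_eq_iff)
qed

lemma G_mult:
  assumes "F \<in> Rees" "F' \<in> Rees"
  shows "\<Theta> F \<otimes>\<^bsub>G\<^esub> \<Theta> F' = \<Theta> (F * F')"
proof
  fix n
  have F: "coeff F i \<in> J i" "coeff F' i \<in> J i" for i
    using assms by (auto simp: Rees_def)
  have "(\<Theta> F \<otimes>\<^bsub>G\<^esub> \<Theta> F') n
      = finsum (A Quot J (Suc n)) (\<lambda>i. rcoset_mult A (J (Suc n)) (\<Theta> F i) (\<Theta> F' (n - i))) {..n}"
    by (simp add: G_eq)
  also have "\<dots> = finsum (A Quot J (Suc n)) (\<lambda>i. gr n (coeff F i * coeff F' (n - i))) {..n}"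
  proof (rule abelian_monoid.finsum_cong')
    show "abelian_monoid (A Quot J (Suc n))"
      using ideal.quotient_is_ring[OF J_ideal] by (simp add: ring_def abelian_group_def)
    show "rcoset_mult A (J (Suc n)) (\<Theta> F i) (\<Theta> F' (n - i)) = gr n (coeff F i * coeff F' (n - i))"
      if "i \<in> {..n}" for i
      using gr_mult[OF F(1)[of i] F(2)[of "n - i"]] that by (simp add: \<Theta>_def)
    show "(\<lambda>i. gr n (coeff F i * coeff F' (n - i))) \<in> {..n} \<rightarrow> carrier (A Quot J (Suc n))"
      using A_mult_closed[OF J_subset[OF F(1)] J_subset[OF F(2)]]
      by (auto simp: FactRing_def A_RCOSETS_def' gr_def)
  qed simp
  also have "\<dots> = gr n (\<Sum>i\<le>n. coeff F i * coeff F' (n - i))"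
    by (intro finsum_gr A_mult_closed J_subset[OF F(1)] J_subset[OF F(2)])
  finally show "(\<Theta> F \<otimes>\<^bsub>G\<^esub> \<Theta> F') n = \<Theta> (F * F') n"
    by (simp add: \<Theta>_def coeff_mult)
qed

lemma G_carrier: "carrier G = \<Theta> ` Rees"
proof
  have car: "u \<in> carrier G \<longleftrightarrow> (\<forall>n. \<exists>x\<in>J n. u n = gr n x) \<and> finite {n. u n \<noteq> gr n 0}" for u
    by (simp add: G_eq)
  show "carrier G \<subseteq> \<Theta> ` Rees"
  proof
    fix u assume u: "u \<in> carrier G"
    \<comment> \<open>The zero class is represented by 0 itself, so that almost all representatives
      vanish and together they form a polynomial.\<close>
    have "\<exists>x. x \<in> J n \<and> u n = gr n x \<and> (u n = gr n 0 \<longrightarrow> x = 0)" for n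
      using u unfolding car by (cases "u n = gr n 0") auto
    then obtain x where x: "\<And>n. x n \<in> J n" "\<And>n. u n = gr n (x n)" "\<And>n. u n = gr n 0 \<Longrightarrow> x n = 0"
      by metis
    have "finite {n. u n \<noteq> gr n 0}"
      using u unfolding car by blast
    then obtain m where "\<forall>n\<in>{n. u n \<noteq> gr n 0}. n \<le> m"
      using finite_nat_set_iff_bounded_le by blast
    then have "coeff (Abs_poly x) = x"
      using x(3) by (intro coeff_Abs_poly[of m]) force
    then have "Abs_poly x \<in> Rees" "\<Theta> (Abs_poly x) = u"
      using x by (auto simp: Rees_def \<Theta>_def)
    then show "u \<in> \<Theta> ` Rees" by blast
  qed
  show "\<Theta> ` Rees \<subseteq> carrier G"
  proof
    fix u assume "u \<in> \<Theta> ` Rees"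
    then obtain F where F: "F \<in> Rees" "u = \<Theta> F" by blast
    have "{n. u n \<noteq> gr n 0} \<subseteq> {..degree F}"
      using coeff_eq_0[of F] by (force simp: F(2) \<Theta>_def not_less[symmetric])
    then show "u \<in> carrier G"
      using F unfolding car by (auto simp: \<Theta>_def Rees_def intro: finite_subset)
  qed
qed

lemma \<Theta>_closed: "F \<in> Rees \<Longrightarrow> \<Theta> F \<in> carrier G"
  by (simp add: G_carrier)

text \<open>The ring laws are inherited from polynomials, since \<open>\<Theta>\<close> respects
  both operations on \<open>Rees\<close> and maps it onto the carrier.\<close>

lemma G_cring: "cring G"
proof (rule cringI)
  show "abelian_group G"
  proof (rule abelian_groupI)
    fix u assume "u \<in> carrier G"
    then obtain F where F: "F \<in> Rees" "u = \<Theta> F" by (auto simp: G_carrier)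
    show "\<exists>v\<in>carrier G. v \<oplus>\<^bsub>G\<^esub> u = \<zero>\<^bsub>G\<^esub>"
      using F by (intro bexI[of _ "\<Theta> (- F)"]) (simp_all add: G_add G_zero Rees_uminus \<Theta>_closed)
  qed (auto simp: G_carrier G_add G_zero Rees_add add_ac)
  show "comm_monoid G"
    by (rule comm_monoidI) (auto simp: G_carrier G_mult G_one Rees_mult mult_ac)
qed (auto simp: G_carrier G_add G_mult Rees_add Rees_mult algebra_simps)

sublocale G: cring G
  by (rule G_cring)

lemma G_pow: "F \<in> Rees \<Longrightarrow> \<Theta> F [^]\<^bsub>G\<^esub> (n::nat) = \<Theta> (F ^ n)"
  by (induction n) (simp_all add: G_one G_mult Rees_power mult.commute)

text \<open>Modulo the nilradical, only the coefficients of \<open>t^(n s)\<close> in degree \<open>n\<close> survive. They are read off by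
  \<open>lead\<close>, which is split by the substitution \<open>p \<mapsto> p(t^s T)\<close>.\<close>

definition lead :: "'k fps poly \<Rightarrow> 'k poly"
  where "lead F = Abs_poly (\<lambda>n. fps_nth (coeff F n) (n * s))"

definition embed :: "'k poly \<Rightarrow> 'k fps poly"
  where "embed p = Abs_poly (\<lambda>n. fps_const (coeff p n) * fps_X ^ (n * s))"

lemma coeff_lead [simp]: "coeff (lead F) n = fps_nth (coeff F n) (n * s)"
  unfolding lead_def by (subst coeff_Abs_poly[of "degree F"]) (simp_all add: coeff_eq_0)

lemma coeff_embed [simp]: "coeff (embed p) n = fps_const (coeff p n) * fps_X ^ (n * s)"
  unfolding embed_def by (subst coeff_Abs_poly[of "degree p"]) (simp_all add: coeff_eq_0)

lemma lead_add: "lead (F + F') = lead F + lead F'"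
  by (simp add: poly_eq_iff)

lemma lead_diff: "lead (F - F') = lead F - lead F'"
  by (simp add: poly_eq_iff)

lemma lead_one: "lead 1 = 1"
  by (simp add: poly_eq_iff)

text \<open>All exponents in degree i are at least i s, so the coefficient of a product at n s
  involves only the lowest coefficients of the factors.\<close>

lemma lead_mult:
  assumes "F \<in> Rees" "F' \<in> Rees"
  shows "lead (F * F') = lead F * lead F'"
proof (rule poly_eqI)
  fix n
  have F: "coeff F i \<in> J i" "coeff F' i \<in> J i" for i
    using assms by (auto simp: Rees_def)
  have "fps_nth (coeff F i * coeff F' (n - i)) (n * s) = coeff (lead F) i * coeff (lead F') (n - i)"
    if "i \<le> n" for i
  proof -
    have "n * s = i * s + (n - i) * s"
      using that by (simp flip: add_mult_distrib)
    then show ?thesis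
      using fps_mult_nth_lowest[of "i * s" "coeff F i" "(n - i) * s" "coeff F' (n - i)"] J_nth_below[OF F(1)] J_nth_below[OF F(2)]
      by simp
  qed
  then show "coeff (lead (F * F')) n = coeff (lead F * lead F') n"
    unfolding coeff_lead by (simp add: coeff_mult fps_sum_nth)
qed

text \<open>I^(n+1) has order at least (n + 1) s, which exceeds n s. Hence the coefficient at n s
  depends only on the class in degree n.\<close>

lemma lead_cong: "\<Theta> F = \<Theta> F' \<Longrightarrow> lead F = lead F'"
  using J_nth_Suc[of "coeff F n - coeff F' n" n for n] by (simp add: \<Theta>_eq_iff poly_eq_iff)

lemma embed_Rees: "embed p \<in> Rees"
proof -
  have "fps_const c * fps_X ^ (n * s) \<in> J n" for c :: 'k and n
    using s_mem_P[of n] by (auto simp: J_def supported_def)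
  then show ?thesis
    by (simp add: Rees_def)
qed

lemma lead_embed [simp]: "lead (embed p) = p"
  by (simp add: poly_eq_iff)

lemma embed_add: "embed (p + q) = embed p + embed q"
  by (simp add: poly_eq_iff distrib_right flip: fps_const_add)

lemma embed_one: "embed 1 = 1"
  by (simp add: poly_eq_iff)

lemma embed_mult: "embed (p * q) = embed p * embed q"
proof (rule poly_eqI)
  fix n
  have "coeff (embed p) i * coeff (embed q) (n - i) = fps_const (coeff p i * coeff q (n - i)) * fps_X ^ (n * s)"
    if "i \<le> n" for i
  proof -
    have "n * s = i * s + (n - i) * s"
      using that by (simp flip: add_mult_distrib)
    then have "(fps_X ^ (n * s) :: 'k fps) = fps_X ^ (i * s) * fps_X ^ ((n - i) * s)"
      by (simp add: power_add)
    then show ?thesis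
      by (simp add: mult_ac flip: fps_const_mult)
  qed
  then show "coeff (embed (p * q)) n = coeff (embed p * embed q) n"
    unfolding coeff_embed coeff_mult by (simp add: fps_const_sum sum_distrib_right)
qed

text \<open>Every exponent of F in degree n exceeds n s. Each factor of a power adds at least one to
  this excess, and an excess of C + s reaches the bound for I^(n+1) in all degrees at once.\<close>

lemma nilpotent_if_lead_zero:
  assumes F: "F \<in> Rees" "lead F = 0"
  shows "\<Theta> F \<in> nilradical G"
proof -
  have order: "n * s + j \<le> x" if "fps_nth (coeff (F ^ j) n) x \<noteq> 0" for j n x
    using that
  proof (induction j arbitrary: n x)
    case 0
    then show ?case
      by (cases n) auto
  next
    case (Suc j)
    obtain i where i: "i \<le> n" "fps_nth (coeff F i * coeff (F ^ j) (n - i)) x \<noteq> 0"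
      using Suc.prems by (auto simp: coeff_mult fps_sum_nth elim: sum.not_neutral_contains_not_neutral)
    then obtain y where y: "y \<le> x" "fps_nth (coeff F i) y \<noteq> 0" "fps_nth (coeff (F ^ j) (n - i)) (x - y) \<noteq> 0"
      unfolding fps_mult_nth by (auto elim: sum.not_neutral_contains_not_neutral)
    have "i * s \<le> y"
      using y(2) F(1) J_nth_below[of "coeff F i" i y] by (force simp: Rees_def)
    moreover have "y \<noteq> i * s"
      using y(2) F(2) coeff_lead[of F i] by auto
    ultimately have "i * s + 1 \<le> y" by simp
    moreover have "(n - i) * s + j \<le> x - y"
      by (rule Suc.IH[OF y(3)])
    moreover have "n * s = i * s + (n - i) * s"
      using i(1) by (simp flip: add_mult_distrib)
    ultimately show ?case
      using y(1) by linarith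
  qed
  have "coeff (F ^ (C + s)) n \<in> J (Suc n)" for n
    unfolding J_def
  proof (rule supportedI)
    fix x assume "fps_nth (coeff (F ^ (C + s)) n) x \<noteq> 0"
    then have "n * s + (C + s) \<le> x"
      by (rule order)
    then show "x \<in> P (Suc n)"
      by (intro P_large) simp
  qed
  then have "\<Theta> (F ^ (C + s)) = \<Theta> 0"
    by (simp add: \<Theta>_eq_iff)
  then have "\<Theta> F [^]\<^bsub>G\<^esub> (C + s) = \<zero>\<^bsub>G\<^esub>"
    by (simp add: G_pow F G_zero)
  then show ?thesis
    using \<Theta>_closed[OF F(1)] by (auto simp: nilradical_def)
qed

text \<open>Compare the components of lowest degree of the two factors.\<close>

lemma embed_nonzerodivisor:
  assumes "p \<noteq> 0"
  shows "nonzerodivisor G (\<Theta> (embed p))"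
  unfolding nonzerodivisor_def
proof (intro conjI ballI impI)
  show "\<Theta> (embed p) \<in> carrier G"
    by (intro \<Theta>_closed embed_Rees)
  fix u assume "u \<in> carrier G" and 0: "\<Theta> (embed p) \<otimes>\<^bsub>G\<^esub> u = \<zero>\<^bsub>G\<^esub>"
  then obtain F where F: "F \<in> Rees" "u = \<Theta> F" by (auto simp: G_carrier)
  have prod: "coeff (embed p * F) n \<in> J (Suc n)" for n
    using 0 by (simp add: F G_mult embed_Rees G_zero \<Theta>_eq_iff)
  define e where "e = (LEAST n. coeff p n \<noteq> 0)"
  have "\<exists>n. coeff p n \<noteq> 0"
    using assms by (auto simp: poly_eq_iff)
  from LeastI_ex[OF this] have e: "coeff p e \<noteq> 0" "\<And>i. i < e \<Longrightarrow> coeff p i = 0"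
    unfolding e_def by (blast dest: not_less_Least)+
  have "coeff F n \<in> J (Suc n)" for n
  proof (induction n rule: less_induct)
    case (less n)
    have split: "{..e + n} = insert e ({..e + n} - {e})" by auto
    have "coeff (embed p) i * coeff F (e + n - i) \<in> J (Suc (e + n))" if i: "i \<in> {..e + n} - {e}" for i
    proof (cases "i < e")
      case True
      then show ?thesis by (simp add: e(2))
    next
      case False
      then have "coeff F (e + n - i) \<in> J (Suc (e + n - i))"
        using i by (intro less) auto
      then have "coeff (embed p) i * coeff F (e + n - i) \<in> J (i + Suc (e + n - i))"
        using embed_Rees[of p] by (intro J_mult) (auto simp: Rees_def)
      moreover have "i + Suc (e + n - i) = Suc (e + n)"
        using i by auto
      ultimately show ?thesis by simp
    qed
    then have "(\<Sum>i\<in>{..e + n} - {e}. coeff (embed p) i * coeff F (e + n - i)) \<in> J (Suc (e + n))"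
      by (rule J_sum)
    from J_diff[OF prod this]
    have "coeff (embed p * F) (e + n) - (\<Sum>i\<in>{..e + n} - {e}. coeff (embed p) i * coeff F (e + n - i))
      \<in> J (Suc (e + n))" .
    moreover have "coeff (embed p * F) (e + n) = coeff (embed p) e * coeff F n
        + (\<Sum>i\<in>{..e + n} - {e}. coeff (embed p) i * coeff F (e + n - i))"
      unfolding coeff_mult by (subst split, subst sum.insert) simp_all
    ultimately have "coeff (embed p) e * coeff F n \<in> J (Suc (e + n))"
      by (simp only: add_diff_cancel_right')
    then have f: "fps_X ^ (e * s) * (fps_const (coeff p e) * coeff F n) \<in> J (Suc (e + n))"
      by (simp add: mult_ac)
    have "x \<in> P (Suc n)" if x: "fps_nth (coeff F n) x \<noteq> 0" for x
    proof -
      have "e * s + x \<in> P (Suc (e + n))"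
        using f x e(1) by (auto simp: J_def supported_def fps_X_power_mult_nth dest: spec[of _ "e * s + x"])
      moreover have "x \<in> H"
        using x F(1) J_subset[of "coeff F n" n] by (auto simp: Rees_def supported_def)
      ultimately show ?thesis
      \<comment> \<open>\<open>P_cancel\<close> removes s only once, so the e copies are stripped
        one by one; each intermediate number must be known to lie in H.\<close>
      proof (induction e)
        case (Suc e)
        have "e * s + x \<in> H"
          using Suc.prems(2) s_mem_P[of e] P_ideal[of e] by (auto simp: exponent_ideal_def intro: add_mem)
        then have "e * s + x \<in> P (Suc (e + n))"
          using P_cancel[of "e * s + x" "Suc (e + n)"] Suc.prems(1) by (simp add: add.assoc)
        then show ?case using Suc by blast
      qed simp
    qed
    then show ?case
      by (auto simp: J_def intro: supportedI)
  qed
  then show "u = \<zero>\<^bsub>G\<^esub>"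
    by (simp add: F G_zero \<Theta>_eq_iff)
qed

text \<open>F differs from the embedded copy of its lead by an element with lead zero, so its class
  is a nonzerodivisor plus a nilpotent.\<close>

lemma nonzerodivisor_if_lead_nonzero:
  assumes F: "F \<in> Rees" "lead F \<noteq> 0"
  shows "nonzerodivisor G (\<Theta> F)"
proof -
  have D: "F - embed (lead F) \<in> Rees"
    using F embed_Rees by (intro Rees_diff)
  have "\<Theta> (F - embed (lead F)) \<in> nilradical G"
    using D by (rule nilpotent_if_lead_zero) (simp add: lead_diff)
  then have "nonzerodivisor G (\<Theta> (embed (lead F)) \<oplus>\<^bsub>G\<^esub> \<Theta> (F - embed (lead F)))"
    using embed_nonzerodivisor[OF F(2)] by (intro G.nonzerodivisor_add_nilpotent)
  then show ?thesis
    by (simp add: G_add embed_Rees D)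
qed

sublocale embed: poly_algebra G "\<lambda>p. \<Theta> (embed p)"
  by unfold_locales (simp_all add: \<Theta>_closed embed_Rees G_add G_mult G_one embed_add embed_mult embed_one)

text \<open>Above degree \<open>d\<close> every homogeneous element is a multiple of the class of \<open>t^s\<close>, and each homogeneous
  component is finite-dimensional over \<open>k\<close>.\<close>

lemma G_noetherian: "noetherian_ring G"
proof -
  define M where "M = {monom (fps_X ^ x :: 'k fps) n | x n. n \<le> d \<and> x \<in> P n \<and> x < C + Suc n * s}"
  have "Suc n * s \<le> Suc d * s" if "n \<le> d" for n
    using that by (intro mult_le_mono1) simp
  then have bound: "x < C + Suc d * s" if "n \<le> d" "x < C + Suc n * s" for x n
    using that by (meson add_left_mono less_le_trans)
  have "M \<subseteq> (\<lambda>(x, n). monom (fps_X ^ x) n) ` ({..<C + Suc d * s} \<times> {..d})"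
  proof
    fix F assume "F \<in> M"
    then obtain x n where "F = monom (fps_X ^ x) n" "n \<le> d" "x < C + Suc n * s"
      unfolding M_def by blast
    then show "F \<in> (\<lambda>(x, n). monom (fps_X ^ x) n) ` ({..<C + Suc d * s} \<times> {..d})"
      using bound by (intro image_eqI[of _ _ "(x, n)"]) simp_all
  qed
  then have "finite (\<Theta> ` M)"
    by (intro finite_imageI) (rule finite_subset, auto)
  then obtain es where es: "set es = \<Theta> ` M"
    using finite_list by blast
  have M: "M \<subseteq> Rees"
    by (auto simp: M_def Rees_monom_iff J_def fps_X_power_supported_iff)
  then have es_closed: "set es \<subseteq> carrier G"
    using es \<Theta>_closed by auto
  let ?span = "linear_span G (\<lambda>p. \<Theta> (embed p)) es"
  define T where "T = {F \<in> Rees. \<Theta> F \<in> ?span}"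
  have T_ker: "F \<in> T" if "F \<in> Rees" "\<Theta> F = \<Theta> 0" for F
    using that embed.linear_span_zero[OF es_closed] by (simp add: T_def G_zero)
  have T_add: "F + F' \<in> T" if "F \<in> T" "F' \<in> T" for F F'
    using that embed.linear_span_add[OF es_closed, of "\<Theta> F" "\<Theta> F'"] by (simp add: T_def G_add Rees_add)
  have T_mult: "embed p * F \<in> T" if "F \<in> T" for F p
    using that embed.linear_span_mult[OF es_closed, of "\<Theta> F" p]
    by (simp add: T_def G_mult embed_Rees Rees_mult)
  have T_sum: "sum f B \<in> T" if "\<And>i. i \<in> B \<Longrightarrow> f i \<in> T" for f :: "nat \<Rightarrow> 'k fps poly" and B
    using that by (induction B rule: infinite_finite_induct) (auto intro: T_add T_ker)
  have T_M: "F \<in> T" if "F \<in> M" for F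
    using that M embed.linear_span_mem[OF es_closed, of "\<Theta> F"] unfolding T_def es by blast
  have T_monom: "monom f n \<in> T" if "f \<in> J n" for f n
    using that
  proof (induction n arbitrary: f rule: less_induct)
    case (less n)
    show ?case
    proof (cases "d < n")
      case True
      have "P n \<subseteq> (+) s ` P (n - 1)"
        using P_reduce[OF _ True] by blast
      then have "f \<in> supported ((+) s ` P (n - 1))"
        using less.prems supported_mono unfolding J_def by blast
      then obtain g where g: "g \<in> J (n - 1)" "f = fps_X ^ s * g"
        unfolding supported_image_add_iff J_def by blast
      have "embed [:0, 1:] = monom (fps_X ^ s) 1"
        by (rule poly_eqI) (auto simp: coeff_pCons split: nat.splits)
      then have "monom f n = embed [:0, 1:] * monom g (n - 1)"
        using True g(2) by (simp add: mult_monom)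
      then show ?thesis
        using T_mult less.IH[of "n - 1" g] g(1) True by simp
    next
      case False
      \<comment> \<open>Terms of order at least D lie in I^(n+1) and vanish in degree n. The
        remaining terms are scalar multiples of the finitely many monomials in M.\<close>
      define D where "D = C + Suc n * s"
      define g where "g = f - (\<Sum>x<D. fps_const (fps_nth f x) * fps_X ^ x)"
      have "fps_nth (\<Sum>x<D. fps_const (fps_nth f x) * fps_X ^ x) y = (if y < D then fps_nth f y else 0)" for y
        by (simp add: fps_sum_nth if_distrib cong: if_cong)
      then have "g \<in> J (Suc n)"
        unfolding J_def g_def using P_large[of "Suc n"] by (intro supportedI) (auto simp: D_def split: if_splits)
      then have g: "monom g n \<in> T"
        by (intro T_ker) (auto simp: Rees_monom_iff J_Suc \<Theta>_eq_iff)
      have "monom (fps_const (fps_nth f x) * fps_X ^ x) n \<in> T" if "x < D" for x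
      proof (cases "fps_nth f x = 0")
        case True
        then show ?thesis using T_ker[of 0] by simp
      next
        case False
        then have "x \<in> P n"
          using less.prems by (auto simp: J_def supported_def)
        then have "monom (fps_X ^ x) n \<in> M"
          using \<open>\<not> d < n\<close> that unfolding M_def D_def not_less by blast
        then have "embed [:fps_nth f x:] * monom (fps_X ^ x) n \<in> T"
          by (intro T_mult T_M)
        moreover have "embed [:fps_nth f x:] = monom (fps_const (fps_nth f x)) 0"
          by (rule poly_eqI) (auto simp: coeff_pCons split: nat.splits)
        ultimately show ?thesis
          by (simp add: mult_monom)
      qed
      then have "(\<Sum>x<D. monom (fps_const (fps_nth f x) * fps_X ^ x) n) + monom g n \<in> T"
        using g by (intro T_add T_sum) auto
      moreover have "monom f n = monom ((\<Sum>x<D. fps_const (fps_nth f x) * fps_X ^ x) + g) n"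
        by (simp add: g_def)
      moreover have "\<dots> = (\<Sum>x<D. monom (fps_const (fps_nth f x) * fps_X ^ x) n) + monom g n"
        by (simp only: monom_sum add_monom[symmetric])
      ultimately show ?thesis
        by (simp only:)
    qed
  qed
  have "carrier G \<subseteq> ?span"
  proof
    fix u assume "u \<in> carrier G"
    then obtain F where F: "F \<in> Rees" "u = \<Theta> F" by (auto simp: G_carrier)
    have "(\<Sum>n\<le>degree F. monom (coeff F n) n) \<in> T"
      using F(1) by (intro T_sum T_monom) (auto simp: Rees_def)
    then show "u \<in> ?span"
      by (simp add: poly_as_sum_of_monoms T_def F(2))
  qed
  then show ?thesis
    by (rule embed.noetherian_of_linear_span[OF es_closed])
qed

theorem assoc_graded_cohen_macaulay: "cohen_macaulay_ring G"
proof -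
  \<comment> \<open>The arbitrary choice of a representative is harmless, because
    \<open>lead\<close> depends only on the class by \<open>lead_cong\<close>.\<close>
  define \<phi> where "\<phi> u = lead (SOME F. F \<in> Rees \<and> \<Theta> F = u)" for u
  have \<phi>: "\<phi> (\<Theta> F) = lead F" if "F \<in> Rees" for F
    unfolding \<phi>_def
    by (rule someI2[where a = F and Q = "\<lambda>F'. lead F' = lead F"]) (auto simp: that intro: lead_cong)
  show ?thesis
  proof (rule G.cohen_macaulay_poly_quotient[of \<phi>])
    show "noetherian_ring G"
      by (rule G_noetherian)
    show "\<exists>u\<in>carrier G. \<phi> u = p" for p
      using \<phi>[OF embed_Rees] \<Theta>_closed[OF embed_Rees] by (intro bexI[of _ "\<Theta> (embed p)"]) simp_all
    show "\<phi> \<one>\<^bsub>G\<^esub> = 1"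
      by (simp add: G_one \<phi> lead_one)
    show "u \<in> nilradical G" if "u \<in> carrier G" "\<phi> u = 0" for u
      using that nilpotent_if_lead_zero by (auto simp: G_carrier \<phi>)
    show "nonzerodivisor G u" if "u \<in> carrier G" "\<phi> u \<noteq> 0" for u
      using that nonzerodivisor_if_lead_nonzero by (auto simp: G_carrier \<phi>)
  qed (auto simp: G_carrier G_add G_mult \<phi> lead_add lead_mult Rees_add Rees_mult)
qed

end

section \<open>Powers of \<open>Q : \<mm>^q\<close>\<close>

context colon_exponents
begin

sublocale numerical_monoid H
  by unfold_locales (use H_add s_mem_H s_pos in auto)

lemma E_exponent_ideal: "exponent_ideal E"
  using E_subset_H E_add by (auto simp: exponent_ideal_def)

text \<open>The exponents of the n-th power of the maximal ideal. The inequality, in place of n =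
  \<alpha> + \<beta>, makes the set closed under adding elements of \<open>H\<close>.\<close>

definition max_pow :: "nat \<Rightarrow> nat set"
  where "max_pow n = {\<alpha> * a + \<beta> * (a + 1) | \<alpha> \<beta>. n \<le> \<alpha> + \<beta>}"

lemma max_powI: "n \<le> \<alpha> + \<beta> \<Longrightarrow> \<alpha> * a + \<beta> * (a + 1) \<in> max_pow n"
  unfolding max_pow_def by blast

lemma max_pow_0: "max_pow 0 = H"
  unfolding max_pow_def H_def semigroup_gen2_def by simp

lemma max_pow_add:
  assumes "x \<in> max_pow m" "y \<in> max_pow n"
  shows "x + y \<in> max_pow (m + n)"
proof -
  obtain \<alpha> \<beta> \<gamma> \<delta> where "x = \<alpha> * a + \<beta> * (a + 1)" "m \<le> \<alpha> + \<beta>" "y = \<gamma> * a + \<delta> * (a + 1)" "n \<le> \<gamma> + \<delta>"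
    using assms unfolding max_pow_def by blast
  then have "x + y = (\<alpha> + \<gamma>) * a + (\<beta> + \<delta>) * (a + 1)" "m + n \<le> (\<alpha> + \<gamma>) + (\<beta> + \<delta>)"
    by (simp_all only: algebra_simps)
  then show ?thesis
    using max_powI[of "m + n" "\<alpha> + \<gamma>" "\<beta> + \<delta>"] by (simp only:)
qed

lemma max_pow_Suc_cases:
  assumes "x \<in> max_pow (Suc n)"
  obtains b y where "b \<in> {a, a + 1}" "y \<in> max_pow n" "x = b + y"
proof -
  obtain \<alpha> \<beta> where x: "x = \<alpha> * a + \<beta> * (a + 1)" "Suc n \<le> \<alpha> + \<beta>"
    using assms unfolding max_pow_def by blast
  show thesis
  proof (cases \<alpha>)
    case (Suc k)
    show thesis
      by (rule that[of a "k * a + \<beta> * (a + 1)"]) (use x Suc max_powI[of n k \<beta>] in auto)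
  next
    case 0
    then obtain k where k: "\<beta> = Suc k"
      using x(2) by (cases \<beta>) auto
    show thesis
      by (rule that[of "a + 1" "\<alpha> * a + k * (a + 1)"]) (use x k 0 max_powI[of n \<alpha> k] in auto)
  qed
qed

lemma gens_mem_max_pow: "b \<in> {a, a + 1} \<Longrightarrow> b \<in> max_pow 1"
  using max_powI[of 1 1 0] max_powI[of 1 0 1] by auto

lemma max_pow_1: "max_pow 1 = sumset {a, a + 1} H"
proof
  show "max_pow 1 \<subseteq> sumset {a, a + 1} H"
    using max_pow_0 by (auto elim!: max_pow_Suc_cases intro: sumsetI)
  show "sumset {a, a + 1} H \<subseteq> max_pow 1"
    using gens_mem_max_pow max_pow_add[of _ 1 _ 0] max_pow_0 unfolding sumset_def by force
qed

lemma max_pow_Suc: "max_pow (Suc n) = sumset (max_pow n) (max_pow 1)"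
proof
  show "max_pow (Suc n) \<subseteq> sumset (max_pow n) (max_pow 1)"
  proof
    fix x assume "x \<in> max_pow (Suc n)"
    then obtain b y where "b \<in> {a, a + 1}" "y \<in> max_pow n" "x = b + y"
      by (rule max_pow_Suc_cases)
    then show "x \<in> sumset (max_pow n) (max_pow 1)"
      using sumsetI[OF _ gens_mem_max_pow, of y "max_pow n" b] by (simp add: add.commute)
  qed
  show "sumset (max_pow n) (max_pow 1) \<subseteq> max_pow (Suc n)"
    using max_pow_add[of _ n _ 1] by (auto simp: sumset_def)
qed

lemma max_pow_1_exponent_ideal: "exponent_ideal (max_pow 1)"
  using max_pow_add[of _ 1 _ 0] max_pow_add[of _ 0 _ 0] gen_mem_H
  by (auto simp: exponent_ideal_def max_pow_0) (auto simp: max_pow_def)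

lemma maximal_ideal_power:
  "ideal_pow A (Idl\<^bsub>A\<^esub> {fps_X ^ a, fps_X ^ (a + 1)}) n = (supported (max_pow n) :: 'k::field fps set)"
  "exponent_ideal (max_pow n)"
proof -
  have "a \<in> H" "a + 1 \<in> H"
    using gen_mem_H[of 1 0] gen_mem_H[of 0 1] by simp_all
  then have "Idl\<^bsub>A\<^esub> ((\<lambda>b. fps_X ^ b) ` {a, a + 1}) = (supported (sumset {a, a + 1} H) :: 'k fps set)"
    by (intro genideal_fps_X_power) simp_all
  then have "Idl\<^bsub>A\<^esub> {fps_X ^ a, fps_X ^ (a + 1)} = (supported (max_pow 1) :: 'k fps set)"
    by (simp only: max_pow_1 image_insert image_empty)
  then show "ideal_pow A (Idl\<^bsub>A\<^esub> {fps_X ^ a, fps_X ^ (a + 1)}) n = (supported (max_pow n) :: 'k fps set)"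
    by (simp only:) (intro ideal_pow_supported(2) max_pow_1_exponent_ideal max_pow_0 max_pow_Suc)
  show "exponent_ideal (max_pow n)"
    by (intro ideal_pow_supported(1)[OF max_pow_1_exponent_ideal] max_pow_0 max_pow_Suc)
qed

section \<open>From exponent sets back to the ideals Q, I and their powers\<close>

lemma colon_eq_supported_E:
  "colon_ideal A (PIdl\<^bsub>A\<^esub> (fps_X ^ s)) (ideal_pow A (Idl\<^bsub>A\<^esub> {fps_X ^ a, fps_X ^ (a + 1)}) q)
    = (supported E :: 'k::field fps set)"
proof -
  have "(\<forall>g\<in>max_pow q. h + g \<in> (+) s ` H) \<longleftrightarrow> h \<in> E" if "h \<in> H" for h
    unfolding mem_E_iff[OF that] max_pow_def by blast
  then have "{h \<in> H. \<forall>g\<in>max_pow q. h + g \<in> (+) s ` H} = E"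
    using E_subset_H by blast
  then show ?thesis
    by (simp only: maximal_ideal_power cgenideal_fps_X_power colon_ideal_supported)
qed

lemma ideal_pow_E: "ideal_pow A (supported E) n = (supported (pow_E n) :: 'k::field fps set)"
  "exponent_ideal (pow_E n)"
  by (rule ideal_pow_supported[OF E_exponent_ideal, of pow_E]; simp)+

lemma principal_prod_supported:
  assumes "exponent_ideal F"
  shows "(PIdl\<^bsub>A\<^esub> (fps_X ^ s)) \<cdot>\<^bsub>A\<^esub> supported F = (supported ((+) s ` F) :: 'k::field fps set)"
proof -
  have "sumset ((+) s ` H) F = (+) s ` F"
  proof
    show "sumset ((+) s ` H) F \<subseteq> (+) s ` F"
      using assms by (fastforce simp: sumset_def exponent_ideal_def add.assoc add.commute[of _ "_ :: nat"])
    show "(+) s ` F \<subseteq> sumset ((+) s ` H) F"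
      using sumsetI[of "s + 0" "(+) s ` H" _ F] by auto
  qed
  then show ?thesis
    by (simp add: cgenideal_fps_X_power ideal_prod_supported assms exponent_ideal_translate s_mem_H)
qed

lemma ideal_pow_2:
  assumes "a * q \<le> s"
  shows "ideal_pow A (supported E) 2 = (PIdl\<^bsub>A\<^esub> (fps_X ^ s)) \<cdot>\<^bsub>A\<^esub> (supported E :: 'k::field fps set)"
proof -
  have "pow_E 2 = (+) s ` E"
    using pow_E_2_if_large[OF assms] sumsetI[OF s_mem_E, of _ E] by (auto simp: pow_E_2)
  then show ?thesis
    by (simp only: ideal_pow_E principal_prod_supported[OF E_exponent_ideal])
qed

lemma pow_E_3_image:
  assumes "a * (q - 1) \<le> s"
  shows "pow_E 3 = (+) s ` pow_E 2"
proof
  show "pow_E 3 \<subseteq> (+) s ` pow_E 2"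
    using pow_E_3[OF assms] by blast
  have "s + x \<in> pow_E (Suc 2)" if "x \<in> pow_E 2" for x
    using that by (rule s_add_pow_E)
  moreover have "Suc 2 = 3"
    by simp
  ultimately show "(+) s ` pow_E 2 \<subseteq> pow_E 3"
    by (simp only: image_subset_iff) blast
qed

lemma ideal_pow_3:
  assumes "a * (q - 1) \<le> s"
  shows "ideal_pow A (supported E) 3
    = (PIdl\<^bsub>A\<^esub> (fps_X ^ s)) \<cdot>\<^bsub>A\<^esub> ideal_pow A (supported E :: 'k::field fps set) 2"
  by (simp only: ideal_pow_E principal_prod_supported pow_E_3_image[OF assms])

text \<open>I^(m+3) = Q I^(m+2) follows from I^3 = Q I^2 by multiplying repeatedly with I.\<close>

lemma pow_E_reduce:
  assumes s: "a * (q - 1) \<le> s" and "x \<in> pow_E n" "2 < n"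
  shows "\<exists>y\<in>pow_E (n - 1). x = s + y"
proof -
  have "\<exists>y\<in>pow_E (m + 2). x = s + y" if "x \<in> pow_E (m + 3)" for m x
    using that
  proof (induction m arbitrary: x)
    case 0
    then show ?case
      unfolding add_0 pow_E_3_image[OF s] by blast
  next
    case (Suc m)
    obtain u v where uv: "u \<in> pow_E (m + 3)" "v \<in> E" "x = u + v"
      using Suc.prems unfolding add_Suc pow_E.simps sumset_def by blast
    obtain y where y: "y \<in> pow_E (m + 2)" "u = s + y"
      using Suc.IH[OF uv(1)] by blast
    have "y + v \<in> pow_E (Suc m + 2)" "x = s + (y + v)"
      unfolding add_Suc pow_E.simps using y uv by (auto intro: sumsetI)
    then show ?case by blast
  qed
  moreover have "n - 3 + 3 = n" "n - 3 + 2 = n - 1"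
    using assms(3) by simp_all
  ultimately show ?thesis
    using assms(2) by metis
qed

text \<open>This is the equality of \<open>Q \<inter> I^(n+1)\<close> and \<open>Q I^n\<close>, which makes the initial form of \<open>t^s\<close>
  a nonzerodivisor on the associated graded ring.\<close>

lemma pow_E_cancel:
  assumes s: "a * (q - 1) \<le> s" and "s + y \<in> pow_E (Suc n)" "y \<in> H"
  shows "y \<in> pow_E n"
proof -
  \<comment> \<open>For n = 1 the claim holds even when I^2 differs from Q I, because y \<in> H is
    exactly what \<open>E_sum_reduce\<close> requires. From n = 2 on, I^(n+1) = Q I^n
    applies.\<close>
  consider "n = 0" | "n = 1" | "2 < Suc n" by linarith
  then show ?thesis
  proof cases
    case 2
    then have "s + y \<in> pow_E 2"
      using assms(2) by (simp add: numeral_2_eq_2)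
    then obtain u v where "u \<in> E" "v \<in> E" "s + y = u + v"
      by (auto simp: pow_E_2 sumset_def)
    then have "y \<in> E"
      using E_sum_reduce[of u v] assms(3) by (metis add_diff_cancel_left')
    then show ?thesis
      using 2 pow_E_1 by simp
  next
    case 3
    then show ?thesis
      using pow_E_reduce[OF s assms(2)] by auto
  qed (use assms in simp)
qed

lemma assoc_graded_E_cohen_macaulay:
  assumes s: "a * (q - 1) \<le> s"
  shows "cohen_macaulay_ring (assoc_graded (A :: 'k::field fps ring) (supported E))"
proof -
  \<comment> \<open>The bound N + a (a - 1) comes from \<open>mem_pow_E_large\<close>, and 2 is the
    reduction number bound given by I^3 = Q I^2.\<close>
  interpret monomial_filtration H pow_E s "N + a * (a - 1)" 2 "supported E :: 'k fps set"
  proof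
    show "supported E = supported (pow_E 1)"
      using pow_E_1 by simp
    show "\<And>x n. x \<in> pow_E n \<Longrightarrow> 2 < n \<Longrightarrow> \<exists>y\<in>pow_E (n - 1). x = s + y"
      by (rule pow_E_reduce[OF s])
    show "\<And>y n. s + y \<in> pow_E (Suc n) \<Longrightarrow> y \<in> H \<Longrightarrow> y \<in> pow_E n"
      by (rule pow_E_cancel[OF s])
  qed (fact s_pos pow_E_sum pow_E_Suc_subset pow_E_ge mult_s_mem_pow_E mem_pow_E_large ideal_pow_E
      pow_E.simps(1))+
  show ?thesis
    by (rule assoc_graded_cohen_macaulay)
qed

end

theorem corollary3p4:
  fixes a q s :: nat and H :: "nat set"
    and A :: "'k::field fps ring" and \<mm> Q I :: "'k fps set"
  assumes "a \<ge> 2"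
    and "H = semigroup_gen2 a (a + 1)"
    and "A = semigroup_ring H"
    and "\<mm> = Idl\<^bsub>A\<^esub> {fps_X ^ a, fps_X ^ (a + 1)}"
    and "0 < s" and "s \<in> H"
    and "0 < q"
    and "Q = PIdl\<^bsub>A\<^esub> (fps_X ^ s)"
    and "I = colon_ideal A Q (ideal_pow A \<mm> q)"
    and "q < a"
  shows "(s \<ge> a * q \<longrightarrow> ideal_pow A I 2 = Q \<cdot>\<^bsub>A\<^esub> I) \<and>
         (s \<ge> a * (q - 1) \<longrightarrow>
            ideal_pow A I 3 = Q \<cdot>\<^bsub>A\<^esub> ideal_pow A I 2 \<and>
            cohen_macaulay_ring (assoc_graded A I))"
proof -
  interpret colon_exponents a q s
    using assms by unfold_locales simp_all
  have A: "A = semigroup_ring (colon_exponents.H a)"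
    using assms(2,3) by (simp only: H_def)
  have I: "I = supported E"
    unfolding assms(9,8,4) A by (rule colon_eq_supported_E)
  show ?thesis
    using ideal_pow_2 ideal_pow_3 assoc_graded_E_cohen_macaulay unfolding I assms(8) A by blast
qed

end
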